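(* Let $K$ be a biconnected weak Kac algebra satisfying the $\lambda$-Markov condition, let $K_s\cong K_t\cong\bigoplus_{\alpha=1}^LM_{m_\alpha}(\mathbb{C})$ and $d=\dim K_s$. Then $d^2$ divides $m_\alpha^2\lambda^{-1}$ for all $\alpha=1,\dots,L$.
   Context: A weak Kac algebra is a finite-dimensional $C^*$-algebra $K$ with linear maps $\Delta:K\to K\otimes K$ (a not necessarily unital $*$-homomorphism), $\varepsilon:K\to\mathbb{C}$ (a positive, not necessarily multiplicative functional) and $S:K\to K$ (a $*$-preserving, anti-multiplicative and anti-comultiplicative map with $S^2=\mathrm{id}$) such that, with $\varepsilon_s(x)=(\mathrm{id}\otimes\varepsilon)((1\otimes x)\Delta(1))$ and $\varepsilon_t(x)=(\varepsilon\otimes\mathrm{id})(\Delta(1)(x\otimes1))$, for all $x,y\in K$: (1) $(\Delta\otimes\mathrm{id})\Delta=(\mathrm{id}\otimes\Delta)\Delta$ and $(\varepsilon\otimes\mathrm{id})\Delta=\mathrm{id}=(\mathrm{id}\otimes\varepsilon)\Delta$; (2) $\varepsilon_s(x)y=(\mathrm{id}\otimes\varepsilon)((1\otimes x)\Delta(y))$; (3) $(\varepsilon_s\otimes\mathrm{id})\Delta(x)=(1\otimes x)\Delta(1)$; (4) $m(S\otimes\mathrm{id})\Delta(x)=\varepsilon_s(x)$, where $m$ is multiplication. The Cartan subalgebras are the unital $C^*$-subalgebras $K_s=\varepsilon_s(K)$, $K_t=\varepsilon_t(K)$. The Haar projection $p_\varepsilon\in K$ is the unique projection with $p_\varepsilon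 x=p_\varepsilon\varepsilon_s(x)$, $xp_\varepsilon=\varepsilon_t(x)p_\varepsilon$ for all $x$, and $\varepsilon_s(p_\varepsilon)=\varepsilon_t(p_\varepsilon)=1$. The normalized Haar trace $\tau$ is the unique faithful trace on $K$ with $(\tau\otimes\mathrm{id})\Delta=(\tau\otimes\varepsilon_s)\Delta$, $(\mathrm{id}\otimes\tau)\Delta=(\varepsilon_t\otimes\tau)\Delta$, $\tau\circ\varepsilon_s=\tau\circ\varepsilon_t=\varepsilon$. Put $E_s=(\tau\otimes\mathrm{id})\Delta$, $E_t=(\mathrm{id}\otimes\tau)\Delta$. The $\lambda$-Markov condition is $E_s(p_\varepsilon)=E_t(p_\varepsilon)=\lambda1$, $\lambda>0$. The dual space $K^*$ is a weak Kac algebra with $\langle\phi\psi,x\rangle=\langle\phi\otimes\psi,\Delta(x)\rangle$, $\langle\Delta(\phi),x\otimes y\rangle=\langle\phi,xy\rangle$, $\langle S(\phi),x\rangle=\langle\phi,S(x)\rangle$, $\langle\phi^*,x\rangle=\overline{\langle\phi,S(x^* )\rangle}$, unit $\varepsilon$, counit $\phi\mapsto\langle\phi,1\rangle$. $K$ is connected if $K_s\cap Z(K)=\mathbb{C}$ ($Z$ = center) and biconnected if both $K$ and $K^*$ are connected. A biconnected $K$ satisfies the $\lambda$-Markov condition for a unique $\lambda$; then $\lambda^{-1}=\dim K/\dim K_s$ is a positive integer. *)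

theory Defs
  imports
    Complex_Main
    "HOL-Library.Poly_Mapping"
    "HOL-Library.FuncSet"
    "HOL-Library.Nonpos_Ints"
    "Jordan_Normal_Form.Schur_Decomposition"
begin

section \<open>Complex vector spaces\<close>

text \<open>The complex analogue of the library class \<^class>\<open>real_vector\<close>.\<close>

class scaleC =
  fixes scaleC :: "complex \<Rightarrow> 'a \<Rightarrow> 'a"  (infixr \<open>*\<^sub>C\<close> 75)

class complex_vector = scaleC + ab_group_add +
  assumes scaleC_add_right: "a *\<^sub>C (x + y) = a *\<^sub>C x + a *\<^sub>C y"
    and scaleC_add_left: "(a + b) *\<^sub>C x = a *\<^sub>C x + b *\<^sub>C x"
    and scaleC_scaleC: "a *\<^sub>C b *\<^sub>C x = (a * b) *\<^sub>C x"
    and scaleC_one: "1 *\<^sub>C x = x"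

global_interpretation complex_vector:
  vector_space "scaleC :: complex \<Rightarrow> 'a \<Rightarrow> 'a::complex_vector"
  by unfold_locales (rule scaleC_add_right scaleC_add_left scaleC_scaleC scaleC_one)+

abbreviation clinear :: "('a::complex_vector \<Rightarrow> 'b::complex_vector) \<Rightarrow> bool" where
  "clinear \<equiv> Vector_Spaces.linear scaleC scaleC"

lemma clinear_iff:
  "clinear f \<longleftrightarrow> (\<forall>x y. f (x + y) = f x + f y) \<and> (\<forall>c x. f (c *\<^sub>C x) = c *\<^sub>C f x)"
  by (simp add: Vector_Spaces.linear_iff complex_vector.vector_space_axioms)

instantiation complex :: complex_vector
begin
definition scaleC_complex :: "complex \<Rightarrow> complex \<Rightarrow> complex" where
  "scaleC_complex = (*)"
instance
  by standard (simp_all add: scaleC_complex_def algebra_simps)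
end

lemma complex_scaleC: "c *\<^sub>C z = c * (z :: complex)"
  by (simp add: scaleC_complex_def)

instantiation poly_mapping :: (type, complex_vector) complex_vector
begin
definition scaleC_poly_mapping ::
  "complex \<Rightarrow> ('a \<Rightarrow>\<^sub>0 'b) \<Rightarrow> ('a \<Rightarrow>\<^sub>0 'b)" where
  "scaleC_poly_mapping c = Poly_Mapping.map (scaleC c)"

lemma lookup_scaleC:
  "Poly_Mapping.lookup (c *\<^sub>C f) k = c *\<^sub>C Poly_Mapping.lookup f k"
  by (simp add: scaleC_poly_mapping_def Poly_Mapping.map.rep_eq when_def)

instance
  by standard
    (auto intro!: poly_mapping_eqI
      simp: lookup_scaleC lookup_add scaleC_add_right scaleC_add_left scaleC_scaleC scaleC_one)
end


section \<open>Algebraic tensor products\<close>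

text \<open>The tensor product is the free complex vector space on pairs modulo the bilinearity
  relations.\<close>

definition tensor_relations :: "('a::complex_vector \<times> 'b::complex_vector \<Rightarrow>\<^sub>0 complex) set" where
  "tensor_relations =
     {Poly_Mapping.single (x + x', y) 1 - Poly_Mapping.single (x, y) 1
        - Poly_Mapping.single (x', y) 1 | x x' y. True} \<union>
     {Poly_Mapping.single (x, y + y') 1 - Poly_Mapping.single (x, y) 1
        - Poly_Mapping.single (x, y') 1 | x y y'. True} \<union>
     {Poly_Mapping.single (c *\<^sub>C x, y) 1 - c *\<^sub>C Poly_Mapping.single (x, y) 1 | c x y. True} \<union>
     {Poly_Mapping.single (x, c *\<^sub>C y) 1 - c *\<^sub>C Poly_Mapping.single (x, y) 1 | c x y. True}"

definition tensor_rel ::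
  "('a::complex_vector \<times> 'b::complex_vector \<Rightarrow>\<^sub>0 complex) \<Rightarrow>
   ('a \<times> 'b \<Rightarrow>\<^sub>0 complex) \<Rightarrow> bool" where
  "tensor_rel f g \<longleftrightarrow> f - g \<in> complex_vector.span tensor_relations"

lemma tensor_rel_equivp:
  "equivp (tensor_rel :: ('a::complex_vector \<times> 'b::complex_vector \<Rightarrow>\<^sub>0 complex) \<Rightarrow> _)"
proof (rule equivpI)
  show "reflp (tensor_rel :: ('a \<times> 'b \<Rightarrow>\<^sub>0 complex) \<Rightarrow> _)"
    by (auto simp: reflp_def tensor_rel_def complex_vector.span_zero)
  show "symp (tensor_rel :: ('a \<times> 'b \<Rightarrow>\<^sub>0 complex) \<Rightarrow> _)"
    unfolding symp_def tensor_rel_def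
    by (metis complex_vector.span_neg minus_diff_eq)
  show "transp (tensor_rel :: ('a \<times> 'b \<Rightarrow>\<^sub>0 complex) \<Rightarrow> _)"
  proof (rule transpI)
    fix f g h :: "'a \<times> 'b \<Rightarrow>\<^sub>0 complex"
    assume "tensor_rel f g" "tensor_rel g h"
    then have "(f - g) + (g - h) \<in> complex_vector.span tensor_relations"
      unfolding tensor_rel_def by (rule complex_vector.span_add)
    then show "tensor_rel f h" by (simp add: tensor_rel_def)
  qed
qed

quotient_type (overloaded) ('a, 'b) tensor =
  "'a::complex_vector \<times> 'b::complex_vector \<Rightarrow>\<^sub>0 complex" / tensor_rel
  by (rule tensor_rel_equivp)

instantiation tensor :: (complex_vector, complex_vector) complex_vector
begin

lift_definition zero_tensor :: "('a, 'b) tensor" is 0 .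

lift_definition plus_tensor :: "('a, 'b) tensor \<Rightarrow> ('a, 'b) tensor \<Rightarrow> ('a, 'b) tensor" is "(+)"
  unfolding tensor_rel_def by (simp only: add_diff_add complex_vector.span_add)

lift_definition minus_tensor :: "('a, 'b) tensor \<Rightarrow> ('a, 'b) tensor \<Rightarrow> ('a, 'b) tensor" is "(-)"
proof -
  fix f f' g g' :: "'a \<times> 'b \<Rightarrow>\<^sub>0 complex"
  assume "tensor_rel f f'" "tensor_rel g g'"
  moreover have "(f - g) - (f' - g') = (f - f') - (g - g')" by (simp add: algebra_simps)
  ultimately show "tensor_rel (f - g) (f' - g')"
    by (simp only: tensor_rel_def complex_vector.span_diff)
qed

lift_definition uminus_tensor :: "('a, 'b) tensor \<Rightarrow> ('a, 'b) tensor" is "uminus"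
  unfolding tensor_rel_def by (simp only: minus_diff_minus complex_vector.span_neg)

lift_definition scaleC_tensor :: "complex \<Rightarrow> ('a, 'b) tensor \<Rightarrow> ('a, 'b) tensor" is "scaleC"
  unfolding tensor_rel_def
  by (simp only: complex_vector.scale_right_diff_distrib[symmetric] complex_vector.span_scale)

instance
  by standard
    (transfer; simp add: tensor_rel_def complex_vector.span_zero algebra_simps
       complex_vector.scale_right_distrib complex_vector.scale_left_distrib)+

end

lift_definition tensor ::
  "'a::complex_vector \<Rightarrow> 'b::complex_vector \<Rightarrow> ('a, 'b) tensor"  (infixr \<open>\<otimes>\<^sub>C\<close> 76)
  is "\<lambda>x y. Poly_Mapping.single (x, y) 1" .

text \<open>\<open>free_lift \<sigma> B\<close> sends \<open>\<Sum> c\<^sub>i (x\<^sub>i, y\<^sub>i)\<close> to \<open>\<Sum> \<sigma> c\<^sub>i B x\<^sub>i y\<^sub>i\<close>. It descends to the tensor product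
  when \<open>B\<close> is biadditive and \<open>\<sigma>\<close>-homogeneous in both arguments; \<open>\<sigma>\<close> is the identity for linear and
  \<open>cnj\<close> for antilinear maps.\<close>

definition free_lift ::
  "(complex \<Rightarrow> complex) \<Rightarrow> ('a \<Rightarrow> 'b \<Rightarrow> 'c::complex_vector) \<Rightarrow>
   ('a \<times> 'b \<Rightarrow>\<^sub>0 complex) \<Rightarrow> 'c" where
  "free_lift \<sigma> B f =
     (\<Sum>p\<in>Poly_Mapping.keys f. \<sigma> (Poly_Mapping.lookup f p) *\<^sub>C B (fst p) (snd p))"

definition tensor_lift ::
  "('a::complex_vector \<Rightarrow> 'b::complex_vector \<Rightarrow> 'c::complex_vector) \<Rightarrow> ('a, 'b) tensor \<Rightarrow> 'c" where
  "tensor_lift B t = free_lift id B (rep_tensor t)"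

definition tensor_antilift ::
  "('a::complex_vector \<Rightarrow> 'b::complex_vector \<Rightarrow> 'c::complex_vector) \<Rightarrow> ('a, 'b) tensor \<Rightarrow> 'c" where
  "tensor_antilift B t = free_lift cnj B (rep_tensor t)"

definition scalar_hom :: "(complex \<Rightarrow> complex) \<Rightarrow> bool" where
  "scalar_hom \<sigma> \<longleftrightarrow> \<sigma> 0 = 0 \<and> \<sigma> 1 = 1 \<and>
     (\<forall>a b. \<sigma> (a + b) = \<sigma> a + \<sigma> b) \<and> (\<forall>a b. \<sigma> (a * b) = \<sigma> a * \<sigma> b)"

definition bisemilinear ::
  "(complex \<Rightarrow> complex) \<Rightarrow>
   ('a::complex_vector \<Rightarrow> 'b::complex_vector \<Rightarrow> 'c::complex_vector) \<Rightarrow> bool" where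
  "bisemilinear \<sigma> B \<longleftrightarrow>
     (\<forall>x x' y. B (x + x') y = B x y + B x' y) \<and> (\<forall>x y y'. B x (y + y') = B x y + B x y') \<and>
     (\<forall>c x y. B (c *\<^sub>C x) y = \<sigma> c *\<^sub>C B x y) \<and> (\<forall>c x y. B x (c *\<^sub>C y) = \<sigma> c *\<^sub>C B x y)"

abbreviation cbilinear ::
  "('a::complex_vector \<Rightarrow> 'b::complex_vector \<Rightarrow> 'c::complex_vector) \<Rightarrow> bool" where
  "cbilinear \<equiv> bisemilinear id"

lemma scalar_hom_id: "scalar_hom id" and scalar_hom_cnj: "scalar_hom cnj"
  by (auto simp: scalar_hom_def)

lemma free_lift_superset:
  assumes "scalar_hom \<sigma>" "finite A" "Poly_Mapping.keys f \<subseteq> A"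
  shows "free_lift \<sigma> B f = (\<Sum>p\<in>A. \<sigma> (Poly_Mapping.lookup f p) *\<^sub>C B (fst p) (snd p))"
  unfolding free_lift_def
  by (rule sum.mono_neutral_left)
    (use assms in \<open>auto simp: scalar_hom_def in_keys_iff complex_vector.scale_zero_left\<close>)

lemma free_lift_add:
  assumes "scalar_hom \<sigma>"
  shows "free_lift \<sigma> B (f + g) = free_lift \<sigma> B f + free_lift \<sigma> B g"
proof -
  let ?A = "Poly_Mapping.keys f \<union> Poly_Mapping.keys g"
  have "Poly_Mapping.keys (f + g) \<subseteq> ?A" by (rule Poly_Mapping.keys_add)
  then show ?thesis
    using assms
    by (simp add: free_lift_superset[of \<sigma> ?A] lookup_add scalar_hom_def
        complex_vector.scale_left_distrib sum.distrib)
qed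

lemma free_lift_scaleC:
  assumes "scalar_hom \<sigma>"
  shows "free_lift \<sigma> B (c *\<^sub>C f) = \<sigma> c *\<^sub>C free_lift \<sigma> B f"
proof -
  have "Poly_Mapping.keys (c *\<^sub>C f) \<subseteq> Poly_Mapping.keys f"
    by (auto simp: in_keys_iff lookup_scaleC scaleC_complex_def)
  then show ?thesis
    using assms
    by (simp add: free_lift_superset[of \<sigma> "Poly_Mapping.keys f"] lookup_scaleC scaleC_complex_def
        scalar_hom_def complex_vector.scale_sum_right)
qed

lemma free_lift_diff:
  assumes "scalar_hom \<sigma>"
  shows "free_lift \<sigma> B (f - g) = free_lift \<sigma> B f - free_lift \<sigma> B g"
  using free_lift_add[OF assms, of B "f - g" g] by simp

lemma free_lift_single:
  assumes "scalar_hom \<sigma>"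
  shows "free_lift \<sigma> B (Poly_Mapping.single (x, y) 1) = B x y"
  using assms by (simp add: free_lift_def scalar_hom_def scaleC_one)

lemma free_lift_respects:
  assumes \<sigma>: "scalar_hom \<sigma>" and B: "bisemilinear \<sigma> B" and fg: "tensor_rel f g"
  shows "free_lift \<sigma> B f = free_lift \<sigma> B g"
proof -
  have "free_lift \<sigma> B (f - g) = 0"
    using fg[unfolded tensor_rel_def]
  proof (induction rule: complex_vector.span_induct)
    case base
    show ?case
      using \<sigma> by (auto simp: complex_vector.subspace_def free_lift_add free_lift_scaleC)
        (simp add: free_lift_def)
  next
    case (step h)
    then show ?case
      using B \<sigma> unfolding tensor_relations_def
      by (auto simp: bisemilinear_def free_lift_diff free_lift_scaleC free_lift_single)
  qed
  then show ?thesis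
    using \<sigma> by (simp add: free_lift_diff)
qed

lemma rep_tensor_rel: "tensor_rel (rep_tensor (abs_tensor f)) f"
  by (simp add: tensor.abs_eq_iff[symmetric] Quotient3_abs_rep[OF Quotient3_tensor])

lemma tensor_lift_tensor: "cbilinear B \<Longrightarrow> tensor_lift B (x \<otimes>\<^sub>C y) = B x y"
  unfolding tensor_lift_def tensor.abs_eq
  by (simp only: free_lift_respects[OF scalar_hom_id _ rep_tensor_rel]
      free_lift_single[OF scalar_hom_id])

lemma clinear_tensor_lift: "cbilinear B \<Longrightarrow> clinear (tensor_lift B)"
  unfolding clinear_iff
proof (intro conjI allI)
  fix s t and c assume B: "cbilinear B"
  have "tensor_lift B (abs_tensor f) = free_lift id B f" for f
    unfolding tensor_lift_def by (rule free_lift_respects[OF scalar_hom_id B rep_tensor_rel])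
  then show "tensor_lift B (s + t) = tensor_lift B s + tensor_lift B t"
    and "tensor_lift B (c *\<^sub>C s) = c *\<^sub>C tensor_lift B s"
    by (induction s; induction t;
        simp add: plus_tensor.abs_eq scaleC_tensor.abs_eq free_lift_add free_lift_scaleC
          scalar_hom_id)+
qed

lemma tensor_antilift_tensor: "bisemilinear cnj B \<Longrightarrow> tensor_antilift B (x \<otimes>\<^sub>C y) = B x y"
  unfolding tensor_antilift_def tensor.abs_eq
  by (simp only: free_lift_respects[OF scalar_hom_cnj _ rep_tensor_rel]
      free_lift_single[OF scalar_hom_cnj])

definition tensor_map ::
  "('a::complex_vector \<Rightarrow> 'c::complex_vector) \<Rightarrow> ('b::complex_vector \<Rightarrow> 'd::complex_vector) \<Rightarrow>
   ('a, 'b) tensor \<Rightarrow> ('c, 'd) tensor" where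
  "tensor_map f g = tensor_lift (\<lambda>x y. f x \<otimes>\<^sub>C g y)"

text \<open>\<open>\<phi> \<otimes> id\<close> and \<open>id \<otimes> \<phi>\<close> for a functional \<open>\<phi>\<close>, with \<open>\<complex> \<otimes> V\<close> and \<open>V \<otimes> \<complex>\<close> identified with \<open>V\<close>.\<close>

definition slice_left ::
  "('a::complex_vector \<Rightarrow> complex) \<Rightarrow> ('a, 'b::complex_vector) tensor \<Rightarrow> 'b" where
  "slice_left \<phi> = tensor_lift (\<lambda>x y. \<phi> x *\<^sub>C y)"

definition slice_right ::
  "('b::complex_vector \<Rightarrow> complex) \<Rightarrow> ('a::complex_vector, 'b) tensor \<Rightarrow> 'a" where
  "slice_right \<phi> = tensor_lift (\<lambda>x y. \<phi> y *\<^sub>C x)"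

definition tensor_flip ::
  "('a::complex_vector, 'b::complex_vector) tensor \<Rightarrow> ('b, 'a) tensor" where
  "tensor_flip = tensor_lift (\<lambda>x y. y \<otimes>\<^sub>C x)"

definition tensor_assoc ::
  "(('a::complex_vector, 'b::complex_vector) tensor, 'c::complex_vector) tensor \<Rightarrow>
   ('a, ('b, 'c) tensor) tensor" where
  "tensor_assoc = tensor_lift (\<lambda>t z. tensor_lift (\<lambda>x y. x \<otimes>\<^sub>C (y \<otimes>\<^sub>C z)) t)"

definition tensor_mult ::
  "('a::complex_vector \<Rightarrow> 'a \<Rightarrow> 'a) \<Rightarrow> ('a, 'a) tensor \<Rightarrow> ('a, 'a) tensor \<Rightarrow> ('a, 'a) tensor" where
  "tensor_mult \<mu> s t =
     tensor_lift (\<lambda>x y. tensor_lift (\<lambda>x' y'. \<mu> x x' \<otimes>\<^sub>C \<mu> y y') t) s"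

definition tensor_star ::
  "('a::complex_vector \<Rightarrow> 'a) \<Rightarrow> ('a, 'a) tensor \<Rightarrow> ('a, 'a) tensor" where
  "tensor_star st = tensor_antilift (\<lambda>x y. st x \<otimes>\<^sub>C st y)"


section \<open>Dual spaces\<close>

typedef (overloaded) 'a cdual = "{\<phi> :: 'a::complex_vector \<Rightarrow> complex. clinear \<phi>}"
  morphisms dual_apply Abs_cdual
  by (rule exI[of _ "\<lambda>_. 0"]) (simp add: clinear_iff complex_scaleC)

setup_lifting type_definition_cdual

instantiation cdual :: (complex_vector) complex_vector
begin

lift_definition zero_cdual :: "'a cdual" is "\<lambda>_. 0"
  by (simp add: clinear_iff complex_scaleC)
lift_definition plus_cdual :: "'a cdual \<Rightarrow> 'a cdual \<Rightarrow> 'a cdual" is "\<lambda>\<phi> \<psi> x. \<phi> x + \<psi> x"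
  by (simp add: clinear_iff complex_scaleC algebra_simps)
lift_definition minus_cdual :: "'a cdual \<Rightarrow> 'a cdual \<Rightarrow> 'a cdual" is "\<lambda>\<phi> \<psi> x. \<phi> x - \<psi> x"
  by (simp add: clinear_iff complex_scaleC algebra_simps)
lift_definition uminus_cdual :: "'a cdual \<Rightarrow> 'a cdual" is "\<lambda>\<phi> x. - \<phi> x"
  by (simp add: clinear_iff complex_scaleC algebra_simps)
lift_definition scaleC_cdual :: "complex \<Rightarrow> 'a cdual \<Rightarrow> 'a cdual" is "\<lambda>c \<phi> x. c * \<phi> x"
  by (simp add: clinear_iff complex_scaleC algebra_simps)

instance
  by standard (transfer; simp add: fun_eq_iff algebra_simps)+

end


section \<open>Finite-dimensional C*-algebras\<close>

text \<open>The structure maps are record fields rather than class operations, because the algebra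
  structure on the dual of a weak Kac algebra depends on the comultiplication.\<close>

record 'a star_alg =
  alg_mult :: "'a \<Rightarrow> 'a \<Rightarrow> 'a"
  alg_one :: 'a
  alg_star :: "'a \<Rightarrow> 'a"

definition cstar_norm :: "('a::complex_vector, 'z) star_alg_scheme \<Rightarrow> ('a \<Rightarrow> real) \<Rightarrow> bool" where
  "cstar_norm A N \<longleftrightarrow>
     (\<forall>x. 0 \<le> N x) \<and> (\<forall>x. N x = 0 \<longleftrightarrow> x = 0) \<and>
     (\<forall>x y. N (x + y) \<le> N x + N y) \<and> (\<forall>c x. N (c *\<^sub>C x) = cmod c * N x) \<and>
     (\<forall>x y. N (alg_mult A x y) \<le> N x * N y) \<and>
     (\<forall>x. N (alg_mult A (alg_star A x) x) = (N x)\<^sup>2)"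

text \<open>Completeness of the norm and existence of a unit are automatic in finite dimension; the unit is
  named here because the weak Kac axioms refer to it. A C*-norm is unique, so only its existence
  is required.\<close>

locale fd_cstar_algebra =
  fixes A :: "('a::complex_vector, 'z) star_alg_scheme"
  assumes finite_dim:
      "\<exists>Basis. finite_dimensional_vector_space (scaleC :: complex \<Rightarrow> 'a \<Rightarrow> 'a) Basis"
    and mult_linear_left: "\<And>y. clinear (\<lambda>x. alg_mult A x y)"
    and mult_linear_right: "\<And>x. clinear (alg_mult A x)"
    and mult_assoc: "\<And>x y z. alg_mult A (alg_mult A x y) z = alg_mult A x (alg_mult A y z)"
    and one_left: "\<And>x. alg_mult A (alg_one A) x = x"
    and one_right: "\<And>x. alg_mult A x (alg_one A) = x"
    and star_add: "\<And>x y. alg_star A (x + y) = alg_star A x + alg_star A y"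
    and star_scaleC: "\<And>c x. alg_star A (c *\<^sub>C x) = cnj c *\<^sub>C alg_star A x"
    and star_mult: "\<And>x y. alg_star A (alg_mult A x y) = alg_mult A (alg_star A y) (alg_star A x)"
    and star_star: "\<And>x. alg_star A (alg_star A x) = x"
    and ex_cstar_norm: "\<exists>N. cstar_norm A N"

definition positive_functional ::
  "('a::complex_vector, 'z) star_alg_scheme \<Rightarrow> ('a \<Rightarrow> complex) \<Rightarrow> bool" where
  "positive_functional A \<phi> \<longleftrightarrow> clinear \<phi> \<and> (\<forall>x. \<phi> (alg_mult A (alg_star A x) x) \<in> \<real>\<^sub>\<ge>\<^sub>0)"

definition faithful_trace ::
  "('a::complex_vector, 'z) star_alg_scheme \<Rightarrow> ('a \<Rightarrow> complex) \<Rightarrow> bool" where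
  "faithful_trace A \<tau> \<longleftrightarrow> positive_functional A \<tau> \<and>
     (\<forall>x y. \<tau> (alg_mult A x y) = \<tau> (alg_mult A y x)) \<and>
     (\<forall>x. \<tau> (alg_mult A (alg_star A x) x) = 0 \<longrightarrow> x = 0)"

definition projection :: "('a, 'z) star_alg_scheme \<Rightarrow> 'a \<Rightarrow> bool" where
  "projection A p \<longleftrightarrow> alg_mult A p p = p \<and> alg_star A p = p"

definition alg_center :: "('a, 'z) star_alg_scheme \<Rightarrow> 'a set" where
  "alg_center A = {z. \<forall>x. alg_mult A z x = alg_mult A x z}"

text \<open>\<open>B\<close> is *-isomorphic to \<open>M\<^bsub>m 1\<^esub>(\<complex>) \<oplus> \<dots> \<oplus> M\<^bsub>m L\<^esub>(\<complex>)\<close>, whose elements are the families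
  of matrices indexed by \<open>{1..L}\<close>. Preservation of the unit follows from bijectivity.\<close>

definition iso_matrix_sum ::
  "('a::complex_vector, 'z) star_alg_scheme \<Rightarrow> 'a set \<Rightarrow> nat \<Rightarrow> (nat \<Rightarrow> nat) \<Rightarrow> bool" where
  "iso_matrix_sum A B L m \<longleftrightarrow>
     (\<exists>f :: 'a \<Rightarrow> nat \<Rightarrow> complex mat.
        bij_betw f B (\<Pi>\<^sub>E \<alpha>\<in>{1..L}. carrier_mat (m \<alpha>) (m \<alpha>)) \<and>
        (\<forall>\<alpha>\<in>{1..L}.
           (\<forall>x\<in>B. \<forall>y\<in>B. f (x + y) \<alpha> = f x \<alpha> + f y \<alpha>) \<and>
           (\<forall>c. \<forall>x\<in>B. f (c *\<^sub>C x) \<alpha> = c \<cdot>\<^sub>m f x \<alpha>) \<and>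
           (\<forall>x\<in>B. \<forall>y\<in>B. f (alg_mult A x y) \<alpha> = f x \<alpha> * f y \<alpha>) \<and>
           (\<forall>x\<in>B. f (alg_star A x) \<alpha> = mat_adjoint (f x \<alpha>))))"


section \<open>Weak Kac algebras\<close>

record (overloaded) 'a weak_kac = "'a::complex_vector star_alg" +
  comult :: "'a \<Rightarrow> ('a, 'a) tensor"
  counit :: "'a \<Rightarrow> complex"
  antipode :: "'a \<Rightarrow> 'a"

definition eps_s :: "'a::complex_vector weak_kac \<Rightarrow> 'a \<Rightarrow> 'a" where
  "eps_s K x = slice_right (counit K)
     (tensor_mult (alg_mult K) (alg_one K \<otimes>\<^sub>C x) (comult K (alg_one K)))"

definition eps_t :: "'a::complex_vector weak_kac \<Rightarrow> 'a \<Rightarrow> 'a" where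
  "eps_t K x = slice_left (counit K)
     (tensor_mult (alg_mult K) (comult K (alg_one K)) (x \<otimes>\<^sub>C alg_one K))"

locale weak_kac_algebra = fd_cstar_algebra K
  for K :: "'a::complex_vector weak_kac" +
  assumes comult_linear: "clinear (comult K)"
    and comult_mult:
      "\<And>x y. comult K (alg_mult K x y) = tensor_mult (alg_mult K) (comult K x) (comult K y)"
    and comult_star: "\<And>x. comult K (alg_star K x) = tensor_star (alg_star K) (comult K x)"
    and counit_positive: "positive_functional K (counit K)"
    and antipode_linear: "clinear (antipode K)"
    and antipode_star: "\<And>x. antipode K (alg_star K x) = alg_star K (antipode K x)"
    and antipode_mult:
      "\<And>x y. antipode K (alg_mult K x y) = alg_mult K (antipode K y) (antipode K x)"
    and antipode_comult:
      "\<And>x. comult K (antipode K x) =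
         tensor_flip (tensor_map (antipode K) (antipode K) (comult K x))"
    and antipode_antipode: "\<And>x. antipode K (antipode K x) = x"
    and coassoc:
      "\<And>x. tensor_assoc (tensor_map (comult K) id (comult K x)) =
         tensor_map id (comult K) (comult K x)"
    and counit_left: "\<And>x. slice_left (counit K) (comult K x) = x"
    and counit_right: "\<And>x. slice_right (counit K) (comult K x) = x"
    and eps_s_mult:
      "\<And>x y. alg_mult K (eps_s K x) y =
         slice_right (counit K) (tensor_mult (alg_mult K) (alg_one K \<otimes>\<^sub>C x) (comult K y))"
    and eps_s_comult:
      "\<And>x. tensor_map (eps_s K) id (comult K x) =
         tensor_mult (alg_mult K) (alg_one K \<otimes>\<^sub>C x) (comult K (alg_one K))"
    and antipode_eps_s:
      "\<And>x. tensor_lift (alg_mult K) (tensor_map (antipode K) id (comult K x)) = eps_s K x"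

definition cartan_s :: "'a::complex_vector weak_kac \<Rightarrow> 'a set" where
  "cartan_s K = range (eps_s K)"

definition cartan_t :: "'a::complex_vector weak_kac \<Rightarrow> 'a set" where
  "cartan_t K = range (eps_t K)"

definition haar_projection :: "'a::complex_vector weak_kac \<Rightarrow> 'a \<Rightarrow> bool" where
  "haar_projection K p \<longleftrightarrow> projection K p \<and>
     (\<forall>x. alg_mult K p x = alg_mult K p (eps_s K x)) \<and>
     (\<forall>x. alg_mult K x p = alg_mult K (eps_t K x) p) \<and>
     eps_s K p = alg_one K \<and> eps_t K p = alg_one K"

definition haar_trace :: "'a::complex_vector weak_kac \<Rightarrow> ('a \<Rightarrow> complex) \<Rightarrow> bool" where
  "haar_trace K \<tau> \<longleftrightarrow> faithful_trace K \<tau> \<and>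
     (\<forall>x. slice_left \<tau> (comult K x) = tensor_lift (\<lambda>y z. \<tau> y *\<^sub>C eps_s K z) (comult K x)) \<and>
     (\<forall>x. slice_right \<tau> (comult K x) = tensor_lift (\<lambda>y z. \<tau> z *\<^sub>C eps_t K y) (comult K x)) \<and>
     (\<forall>x. \<tau> (eps_s K x) = counit K x) \<and> (\<forall>x. \<tau> (eps_t K x) = counit K x)"

definition expect_s :: "'a::complex_vector weak_kac \<Rightarrow> ('a \<Rightarrow> complex) \<Rightarrow> 'a \<Rightarrow> 'a" where
  "expect_s K \<tau> x = slice_left \<tau> (comult K x)"

definition expect_t :: "'a::complex_vector weak_kac \<Rightarrow> ('a \<Rightarrow> complex) \<Rightarrow> 'a \<Rightarrow> 'a" where
  "expect_t K \<tau> x = slice_right \<tau> (comult K x)"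

text \<open>Every weak Kac algebra has exactly one Haar projection and exactly one normalized Haar trace,
  so it does not matter how \<open>p\<close> and \<open>\<tau>\<close> are quantified here.\<close>

definition markov_condition :: "'a::complex_vector weak_kac \<Rightarrow> real \<Rightarrow> bool" where
  "markov_condition K l \<longleftrightarrow> 0 < l \<and>
     (\<exists>p \<tau>. haar_projection K p \<and> haar_trace K \<tau> \<and>
        expect_s K \<tau> p = complex_of_real l *\<^sub>C alg_one K \<and>
        expect_t K \<tau> p = complex_of_real l *\<^sub>C alg_one K)"

text \<open>The dual structure. The comultiplication is described by
  \<open>\<langle>\<Delta>(\<phi>), x \<otimes> y\<rangle> = \<langle>\<phi>, xy\<rangle>\<close>, which determines an element of the tensor square of the dual
  because the space is finite-dimensional.\<close>

definition dual_pair ::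
  "('a::complex_vector cdual, 'a cdual) tensor \<Rightarrow> 'a \<Rightarrow> 'a \<Rightarrow> complex" where
  "dual_pair T x y = tensor_lift (\<lambda>\<phi> \<psi>. dual_apply \<phi> x * dual_apply \<psi> y) T"

definition dual_kac :: "'a::complex_vector weak_kac \<Rightarrow> 'a cdual weak_kac" where
  "dual_kac K =
     \<lparr> alg_mult = (\<lambda>\<phi> \<psi>. Abs_cdual (\<lambda>x.
         tensor_lift (\<lambda>y z. dual_apply \<phi> y * dual_apply \<psi> z) (comult K x))),
       alg_one = Abs_cdual (counit K),
       alg_star = (\<lambda>\<phi>. Abs_cdual (\<lambda>x. cnj (dual_apply \<phi> (antipode K (alg_star K x))))),
       comult = (\<lambda>\<phi>. THE T. \<forall>x y. dual_pair T x y = dual_apply \<phi> (alg_mult K x y)),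
       counit = (\<lambda>\<phi>. dual_apply \<phi> (alg_one K)),
       antipode = (\<lambda>\<phi>. Abs_cdual (\<lambda>x. dual_apply \<phi> (antipode K x))) \<rparr>"

definition connected_kac :: "'a::complex_vector weak_kac \<Rightarrow> bool" where
  "connected_kac K \<longleftrightarrow> cartan_s K \<inter> alg_center K = range (\<lambda>c. c *\<^sub>C alg_one K)"

definition biconnected :: "'a::complex_vector weak_kac \<Rightarrow> bool" where
  "biconnected K \<longleftrightarrow> connected_kac K \<and> connected_kac (dual_kac K)"

end

theory Submission
  imports Defs
begin

text \<open>Write \<open>\<tau>\<close> for the Haar trace and \<open>p\<close> for the Haar projection. The Markov condition says that
  \<open>p\<^sub>1 \<otimes> p\<^sub>2 = \<Delta>(p)\<close> satisfies \<open>S(p\<^sub>1) \<tau>(p\<^sub>2 x) = \<lambda> x\<close>, so the trace of \<open>v \<mapsto> x v y\<close> on \<open>K\<close> is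
  \<open>\<lambda>\<^sup>-\<^sup>1 \<tau>(p\<^sub>2 x S(p\<^sub>1) y)\<close>. For \<open>z \<in> K\<^sub>s\<close> the average \<open>p\<^sub>2 z S(p\<^sub>1)\<close> lies in \<open>K\<^sub>s\<close> and in the centre of \<open>K\<close>,
  hence is a scalar, and the trace of \<open>v \<mapsto> z v y\<close> is \<open>\<lambda>\<^sup>-\<^sup>1 \<tau>(z) \<tau>(y) / \<tau>(1)\<close>. Connectedness of the
  dual means \<open>K\<^sub>s \<inter> K\<^sub>t = \<complex>\<close> and makes \<open>\<tau>\<close> multiplicative, up to the factor \<open>\<tau>(1) = d\<close>, on products
  from \<open>K\<^sub>s\<close> and \<open>K\<^sub>t\<close>; on \<open>K\<^sub>s\<close> it is the trace of the regular representation, so \<open>\<tau>(e\<^sub>\<alpha>) = m\<^sub>\<alpha>\<close> for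
  a minimal projection \<open>e\<^sub>\<alpha>\<close> of the block \<open>\<alpha>\<close>.

  Fix \<open>\<alpha>, \<beta>\<close> and let \<open>N\<^sub>\<gamma>\<^sub>\<delta>\<close> be the dimension of \<open>e\<^sub>\<gamma> S(e\<^sub>\<delta>) K e\<^sub>\<alpha> S(e\<^sub>\<beta>)\<close>. The trace formula gives
  \<open>N m = k m\<close> with \<open>k = m\<^sub>\<alpha> m\<^sub>\<beta> \<lambda>\<^sup>-\<^sup>1 / d\<^sup>2\<close>. A rational eigenvalue of an integer matrix is an integer, so
  every such \<open>k\<close> is a natural number; the claims follow from \<open>\<beta> = \<alpha>\<close> and from \<open>\<Sum>\<^sub>\<alpha> m\<^sub>\<alpha>\<^sup>2 = d\<close>.\<close>

section \<open>Tensors as finite sums\<close>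

lemma clinear_add: "clinear f \<Longrightarrow> f (x + y) = f x + f y"
  and clinear_scale: "clinear f \<Longrightarrow> f (c *\<^sub>C x) = c *\<^sub>C f x"
  by (simp_all add: clinear_iff)

lemma clinear_zero: "clinear f \<Longrightarrow> f 0 = 0"
  using clinear_scale[of f 0 0] by simp

lemma clinear_sum: "clinear f \<Longrightarrow> f (\<Sum>i\<in>I. g i) = (\<Sum>i\<in>I. f (g i))"
  by (induction I rule: infinite_finite_induct) (simp_all add: clinear_zero clinear_add)

lemma clinear_compose: "clinear f \<Longrightarrow> clinear g \<Longrightarrow> clinear (\<lambda>x. f (g x))"
  by (simp add: clinear_iff)

lemma clinear_subspace_range:
  assumes f: "clinear f" shows "complex_vector.subspace (range f)"
  unfolding complex_vector.subspace_def
proof (intro conjI ballI allI)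
  show "0 \<in> range f"
    by (metis f clinear_zero rangeI)
  fix x y c assume "x \<in> range f" "y \<in> range f"
  then obtain u v where "x = f u" "y = f v" by blast
  then show "x + y \<in> range f" "c *\<^sub>C x \<in> range f"
    by (metis f clinear_add rangeI) (metis f \<open>x = f u\<close> clinear_scale rangeI)
qed

lemma cbilinear_iff:
  "cbilinear B \<longleftrightarrow> (\<forall>y. clinear (\<lambda>x. B x y)) \<and> (\<forall>x. clinear (\<lambda>y. B x y))"
  by (auto simp: bisemilinear_def clinear_iff)

lemma cbilinearI:
  "(\<And>y. clinear (\<lambda>x. B x y)) \<Longrightarrow> (\<And>x. clinear (\<lambda>y. B x y)) \<Longrightarrow> cbilinear (\<lambda>x y. B x y)"
  by (simp add: cbilinear_iff)

lemma clinear_bilinear: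
  "cbilinear B \<Longrightarrow> clinear f \<Longrightarrow> clinear (\<lambda>x. B (f x) b)"
  "cbilinear B \<Longrightarrow> clinear f \<Longrightarrow> clinear (\<lambda>x. B b (f x))"
  by (simp_all add: bisemilinear_def clinear_iff)

text \<open>Each rule peels off one operation, so that \<open>intro clin\<close> proves linearity of
  a nested Sweedler expression in a chosen variable and, together with \<open>cbilinearI\<close>,
  the bilinearity conditions carried by the Sweedler identities.\<close>

named_theorems clin

lemma clinear_ident [clin]: "clinear (\<lambda>x. x)"
  by (simp add: clinear_iff)

lemma clinear_scaleC_left [clin]: "clinear (g :: _ \<Rightarrow> complex) \<Longrightarrow> clinear (\<lambda>x. g x *\<^sub>C v)"
  by (simp add: clinear_iff complex_vector.scale_left_distrib complex_scaleC)

lemma clinear_scaleC_right [clin]: "clinear f \<Longrightarrow> clinear (\<lambda>x. c *\<^sub>C f x)"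
  by (simp add: clinear_iff complex_vector.scale_right_distrib mult.commute)

lemma clinear_times_left [clin]: "clinear f \<Longrightarrow> clinear (\<lambda>x. f x * (c::complex))"
  and clinear_times_right [clin]: "clinear f \<Longrightarrow> clinear (\<lambda>x. (c::complex) * f x)"
  by (simp_all add: clinear_iff complex_scaleC algebra_simps)

text \<open>The two sides of each law differ by a single generator of
  \<open>tensor_relations\<close>.\<close>

lemma cbilinear_tensor: "cbilinear (\<otimes>\<^sub>C)"
proof -
  have "abs_tensor f = abs_tensor g" if "f - g \<in> tensor_relations"
    for f g :: "'a \<times> 'b \<Rightarrow>\<^sub>0 complex"
    using that by (simp add: tensor.abs_eq_iff tensor_rel_def complex_vector.span_base)
  note eq = this
  have A: "(x + x') \<otimes>\<^sub>C y = x \<otimes>\<^sub>C y + x' \<otimes>\<^sub>C y" "x \<otimes>\<^sub>C (y + y') = x \<otimes>\<^sub>C y + x \<otimes>\<^sub>C y'"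
    "(c *\<^sub>C x) \<otimes>\<^sub>C y = c *\<^sub>C (x \<otimes>\<^sub>C y)" "x \<otimes>\<^sub>C (c *\<^sub>C y) = c *\<^sub>C (x \<otimes>\<^sub>C y)"
    for x x' :: 'a and y y' :: 'b and c
    unfolding tensor.abs_eq plus_tensor.abs_eq scaleC_tensor.abs_eq
    by (rule eq; force simp: tensor_relations_def diff_diff_eq[symmetric])+
  then show ?thesis
    by (simp add: bisemilinear_def)
qed

lemma clinear_tensor_left [clin]: "clinear f \<Longrightarrow> clinear (\<lambda>x. f x \<otimes>\<^sub>C y)"
  and clinear_tensor_right [clin]: "clinear g \<Longrightarrow> clinear (\<lambda>x. y \<otimes>\<^sub>C g x)"
  using clinear_compose[of "\<lambda>x. x \<otimes>\<^sub>C y" f] clinear_compose[of "\<lambda>x. y \<otimes>\<^sub>C x" g]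
  by (simp_all add: cbilinear_tensor[unfolded cbilinear_iff])

text \<open>Scalars are absorbed into the first factor, so sums of pure tensors already give every
  tensor.\<close>

lemma tensor_induct [case_names pure add]:
  assumes pure: "\<And>x y. P (x \<otimes>\<^sub>C y)" and add: "\<And>s t. P s \<Longrightarrow> P t \<Longrightarrow> P (s + t)"
  shows "P t"
proof (induction t)
  case (1 f)
  have single: "P (abs_tensor (Poly_Mapping.single k v))" for k :: "'a \<times> 'b" and v
  proof -
    have "Poly_Mapping.single k v = v *\<^sub>C Poly_Mapping.single k (1::complex)"
      by (rule poly_mapping_eqI) (simp add: lookup_scaleC lookup_single when_def complex_scaleC)
    then have "abs_tensor (Poly_Mapping.single k v) = v *\<^sub>C (fst k \<otimes>\<^sub>C snd k)"
      by (simp add: tensor.abs_eq scaleC_tensor.abs_eq)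
    also have "\<dots> = (v *\<^sub>C fst k) \<otimes>\<^sub>C snd k"
      by (rule clinear_scale[OF clinear_tensor_left[OF clinear_ident], symmetric])
    finally show ?thesis
      by (simp only: pure)
  qed
  have "P (abs_tensor (\<Sum>k\<in>A. Poly_Mapping.single k (Poly_Mapping.lookup f k)))" for A
  proof (induction A rule: infinite_finite_induct)
    case (insert k A)
    then show ?case by (simp add: plus_tensor.abs_eq[symmetric] add single)
  \<comment> \<open>The empty sum is the class of a \<open>single\<close> with coefficient
    0.\<close>
  qed (use single[of undefined 0] in simp_all)
  moreover have "(\<Sum>k\<in>Poly_Mapping.keys f. Poly_Mapping.single k (Poly_Mapping.lookup f k)) = f"
    by (rule poly_mapping_eqI)
      (simp add: lookup_sum lookup_single when_def in_keys_iff sum.delta)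
  ultimately show ?case by metis
qed

lemma tensor_ext:
  assumes "clinear F" "clinear G" "\<And>x y. F (x \<otimes>\<^sub>C y) = G (x \<otimes>\<^sub>C y)"
  shows "F t = G t"
  by (induction t rule: tensor_induct) (simp_all add: assms clinear_add)

lemma tensor_eq_sum_list: "\<exists>ps. t = (\<Sum>p\<leftarrow>ps. fst p \<otimes>\<^sub>C snd p)"
proof (induction t rule: tensor_induct)
  case (pure x y)
  show ?case by (rule exI[of _ "[(x, y)]"]) simp
next
  case (add s t)
  then obtain ps qs where "s = (\<Sum>p\<leftarrow>ps. fst p \<otimes>\<^sub>C snd p)" "t = (\<Sum>p\<leftarrow>qs. fst p \<otimes>\<^sub>C snd p)"
    by blast
  then have "s + t = (\<Sum>p\<leftarrow>ps @ qs. fst p \<otimes>\<^sub>C snd p)" by simp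
  then show ?case by blast
qed

definition tensor_terms ::
  "('a::complex_vector, 'b::complex_vector) tensor \<Rightarrow> ('a \<times> 'b) list" where
  "tensor_terms t = (SOME ps. t = (\<Sum>p\<leftarrow>ps. fst p \<otimes>\<^sub>C snd p))"

text \<open>\<open>tensor_sum t B\<close> is the Sweedler sum \<open>\<Sum> B t\<^sub>1 t\<^sub>2\<close> over one chosen decomposition of \<open>t\<close>. Summing over
  a fixed decomposition lets linear maps be pulled out and sums be interchanged without any
  condition on \<open>B\<close>; only independence of the decomposition needs bilinearity.\<close>

definition tensor_sum ::
  "('a::complex_vector, 'b::complex_vector) tensor \<Rightarrow> ('a \<Rightarrow> 'b \<Rightarrow> 'c::complex_vector) \<Rightarrow> 'c" where
  "tensor_sum t B = (\<Sum>i<length (tensor_terms t). B (fst (tensor_terms t ! i)) (snd (tensor_terms t ! i)))"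

lemma tensor_sum_pure: "tensor_sum t (\<otimes>\<^sub>C) = t"
proof -
  have "t = (\<Sum>p\<leftarrow>tensor_terms t. fst p \<otimes>\<^sub>C snd p)"
    unfolding tensor_terms_def by (rule someI_ex) (rule tensor_eq_sum_list)
  then show ?thesis
    by (simp add: tensor_sum_def sum_list_sum_nth atLeast0LessThan)
qed

lemma clinear_tensor_sum: "clinear F \<Longrightarrow> F (tensor_sum t B) = tensor_sum t (\<lambda>x y. F (B x y))"
  by (simp add: tensor_sum_def clinear_sum)

text \<open>The linear map \<open>tensor_lift B\<close> is applied to the chosen decomposition of
  \<open>t\<close>; here bilinearity makes the choice irrelevant.\<close>

lemma tensor_sum_lift: "cbilinear B \<Longrightarrow> tensor_sum t B = tensor_lift B t"
  using clinear_tensor_sum[OF clinear_tensor_lift, of B t "(\<otimes>\<^sub>C)"]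
  by (simp add: tensor_sum_pure tensor_lift_tensor)

lemma tensor_sum_swap:
  "tensor_sum t (\<lambda>x y. tensor_sum s (B x y)) = tensor_sum s (\<lambda>u v. tensor_sum t (\<lambda>x y. B x y u v))"
  unfolding tensor_sum_def by (rule sum.swap)

lemma tensor_sum_in_subspace:
  assumes "complex_vector.subspace V" "\<And>x y. B x y \<in> V"
  shows "tensor_sum t B \<in> V"
  unfolding tensor_sum_def by (rule complex_vector.subspace_sum) (use assms in auto)

lemma clinear_tensor_sum_param [clin]:
  "(\<And>a b. clinear (\<lambda>x. B x a b)) \<Longrightarrow> clinear (\<lambda>x. tensor_sum t (\<lambda>a b. B x a b))"
  by (auto simp: clinear_iff tensor_sum_def complex_vector.scale_sum_right sum.distrib)

lemma clinear_tensor_sum_arg: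
  assumes "cbilinear B" shows "clinear (\<lambda>t. tensor_sum t B)"
  using clinear_tensor_lift[OF assms] by (simp add: tensor_sum_lift[OF assms])

lemma clinear_tensor_sum_comp [clin]:
  "clinear f \<Longrightarrow> (\<And>y. clinear (\<lambda>x. B x y)) \<Longrightarrow> (\<And>x. clinear (\<lambda>y. B x y)) \<Longrightarrow>
    clinear (\<lambda>x. tensor_sum (f x) (\<lambda>x y. B x y))"
  by (rule clinear_compose[OF clinear_tensor_sum_arg[OF cbilinearI]])

lemma tensor_sum_tensor:
  assumes "cbilinear B" shows "tensor_sum (x \<otimes>\<^sub>C y) B = B x y"
  by (simp add: tensor_sum_lift assms tensor_lift_tensor)

lemma tensor_sum_eqI:
  assumes "clinear F" "cbilinear B" "\<And>x y. F (x \<otimes>\<^sub>C y) = B x y"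
  shows "F t = tensor_sum t B"
  by (rule tensor_ext[OF assms(1)])
    (simp_all add: clinear_tensor_sum_arg assms tensor_sum_tensor)

section \<open>Sweedler sums over images, flips, products and reassociations of tensors\<close>

lemma clinear_tensor_map: "clinear f \<Longrightarrow> clinear g \<Longrightarrow> clinear (tensor_map f g)"
  unfolding tensor_map_def by (intro clinear_tensor_lift cbilinearI clin)

lemma tensor_map_tensor: "clinear f \<Longrightarrow> clinear g \<Longrightarrow> tensor_map f g (x \<otimes>\<^sub>C y) = f x \<otimes>\<^sub>C g y"
  unfolding tensor_map_def by (intro tensor_lift_tensor cbilinearI clin)

lemma tensor_sum_map:
  assumes "cbilinear B" "clinear f" "clinear g"
  shows "tensor_sum (tensor_map f g t) B = tensor_sum t (\<lambda>x y. B (f x) (g y))"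
proof (rule tensor_sum_eqI)
  show "clinear (\<lambda>t. tensor_sum (tensor_map f g t) B)"
    by (rule clinear_compose[OF clinear_tensor_sum_arg clinear_tensor_map]) fact+
  show "cbilinear (\<lambda>x y. B (f x) (g y))"
    using assms by (simp add: cbilinear_iff clinear_iff)
qed (simp add: assms tensor_map_tensor tensor_sum_tensor)

lemma tensor_sum_flip:
  assumes "cbilinear B"
  shows "tensor_sum (tensor_flip t) B = tensor_sum t (\<lambda>x y. B y x)"
proof -
  have flip: "cbilinear (\<lambda>(x::'b) (y::'a). y \<otimes>\<^sub>C x)"
    by (intro cbilinearI clin)
  show ?thesis
  proof (rule tensor_sum_eqI)
    show "clinear (\<lambda>t. tensor_sum (tensor_flip t) B)"
      unfolding tensor_flip_def
      by (rule clinear_compose[OF clinear_tensor_sum_arg clinear_tensor_lift]) fact+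
    show "cbilinear (\<lambda>x y. B y x)"
      using assms by (simp add: cbilinear_iff)
  qed (simp add: tensor_flip_def tensor_lift_tensor[OF flip] tensor_sum_tensor assms)
qed

lemma tensor_sum_tensor_mult:
  assumes \<mu>: "cbilinear \<mu>" and B: "cbilinear B"
  shows "tensor_sum (tensor_mult \<mu> s t) B =
    tensor_sum s (\<lambda>a b. tensor_sum t (\<lambda>c d. B (\<mu> a c) (\<mu> b d)))"
proof -
  note lin = clin clinear_bilinear[OF \<mu>]
  have inner: "cbilinear (\<lambda>c d. \<mu> a c \<otimes>\<^sub>C \<mu> b d)" for a b
    by (intro cbilinearI lin)
  have eq: "tensor_mult \<mu> s t = tensor_sum s (\<lambda>a b. tensor_sum t (\<lambda>c d. \<mu> a c \<otimes>\<^sub>C \<mu> b d))"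
    unfolding tensor_mult_def tensor_sum_lift[OF inner, symmetric]
    by (rule tensor_sum_lift[symmetric]) (intro cbilinearI lin)
  show ?thesis
    unfolding eq
    by (simp add: clinear_tensor_sum[OF clinear_tensor_sum_arg[OF B]] tensor_sum_tensor[OF B])
qed

text \<open>Turns \<open>tensor_assoc\<close> into an identity of nested Sweedler sums, the form in
  which \<open>sw_coassoc\<close> needs coassociativity.\<close>

lemma tensor_sum_assoc:
  fixes T :: "'a::complex_vector \<Rightarrow> 'b::complex_vector \<Rightarrow> 'c::complex_vector \<Rightarrow> 'd::complex_vector"
  assumes T: "\<And>y z. clinear (\<lambda>x. T x y z)" "\<And>x z. clinear (\<lambda>y. T x y z)" "\<And>x y. clinear (\<lambda>z. T x y z)"
  shows "tensor_sum (tensor_assoc t) (\<lambda>x s. tensor_sum s (T x)) =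
    tensor_sum t (\<lambda>s z. tensor_sum s (\<lambda>x y. T x y z))"
proof -
  have in1: "cbilinear (\<lambda>(x::'a) (y::'b). x \<otimes>\<^sub>C (y \<otimes>\<^sub>C z))" for z :: 'c
    by (intro cbilinearI clin)
  have lin: "clinear (\<lambda>z::'c. tensor_lift (\<lambda>(x::'a) (y::'b). x \<otimes>\<^sub>C (y \<otimes>\<^sub>C z)) s)" for s
    unfolding tensor_sum_lift[OF in1, symmetric] by (intro clin)
  have out: "cbilinear (\<lambda>s (z::'c). tensor_lift (\<lambda>(x::'a) (y::'b). x \<otimes>\<^sub>C (y \<otimes>\<^sub>C z)) s)"
    by (intro cbilinearI lin clinear_tensor_lift in1)
  have B: "cbilinear (\<lambda>x s. tensor_sum s (T x))"
    using T by (intro cbilinearI clinear_tensor_sum_param clinear_tensor_sum_arg)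
  show ?thesis
  proof (rule tensor_sum_eqI)
    show "clinear (\<lambda>t. tensor_sum (tensor_assoc t) (\<lambda>x s. tensor_sum s (T x)))"
      unfolding tensor_assoc_def
      by (rule clinear_compose[OF clinear_tensor_sum_arg[OF B] clinear_tensor_lift[OF out]])
    show "cbilinear (\<lambda>s z. tensor_sum s (\<lambda>x y. T x y z))"
      using T by (intro cbilinearI clinear_tensor_sum_param clinear_tensor_sum_arg)
  next
    fix s :: "('a, 'b) tensor" and z :: 'c
    have "tensor_assoc (s \<otimes>\<^sub>C z) = tensor_sum s (\<lambda>x y. x \<otimes>\<^sub>C (y \<otimes>\<^sub>C z))"
      by (simp add: tensor_assoc_def tensor_lift_tensor[OF out] tensor_sum_lift[OF in1])
    then show "tensor_sum (tensor_assoc (s \<otimes>\<^sub>C z)) (\<lambda>x s. tensor_sum s (T x)) =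
        tensor_sum s (\<lambda>x y. T x y z)"
      using T by (simp add: clinear_tensor_sum[OF clinear_tensor_sum_arg[OF B]]
          tensor_sum_tensor[OF B] tensor_sum_tensor[OF cbilinearI])
  qed
qed

section \<open>Sweedler calculus\<close>

context weak_kac_algebra
begin

abbreviation mul (infixl \<open>\<cdot>\<close> 78) where "x \<cdot> y \<equiv> alg_mult K x y"
abbreviation one (\<open>\<^bold>1\<close>) where "\<^bold>1 \<equiv> alg_one K"
abbreviation S where "S \<equiv> antipode K"
abbreviation \<epsilon> where "\<epsilon> \<equiv> counit K"
abbreviation \<epsilon>\<^sub>s where "\<epsilon>\<^sub>s \<equiv> eps_s K"
abbreviation \<epsilon>\<^sub>t where "\<epsilon>\<^sub>t \<equiv> eps_t K"
abbreviation K\<^sub>s where "K\<^sub>s \<equiv> cartan_s K"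
abbreviation K\<^sub>t where "K\<^sub>t \<equiv> cartan_t K"
abbreviation sw where "sw x B \<equiv> tensor_sum (comult K x) B"

lemma clinear_id: "clinear id"
  by (simp add: clinear_iff)

lemma counit_linear: "clinear \<epsilon>"
  using counit_positive by (simp add: positive_functional_def)

lemmas clinear_mult_left [clin] = clinear_compose[OF mult_linear_left]
  and clinear_mult_right [clin] = clinear_compose[OF mult_linear_right]
  and clinear_antipode [clin] = clinear_compose[OF antipode_linear]
  and clinear_counit [clin] = clinear_compose[OF counit_linear]
  and clinear_comult [clin] = clinear_compose[OF comult_linear]

lemmas sw_simps = clinear_tensor_sum[OF mult_linear_left] clinear_tensor_sum[OF mult_linear_right]
  clinear_tensor_sum[OF antipode_linear] clinear_tensor_sum[OF counit_linear]
  clinear_scale[OF mult_linear_left] clinear_scale[OF mult_linear_right]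
  clinear_scale[OF antipode_linear] clinear_scale[OF counit_linear] complex_scaleC

lemma cbilinear_mult: "cbilinear (\<cdot>)"
  by (intro cbilinearI clin)

lemmas tensor_sum_mult = tensor_sum_tensor_mult[OF cbilinear_mult]

lemma sw_mult:
  "cbilinear B \<Longrightarrow> sw (x \<cdot> y) B = sw x (\<lambda>a b. sw y (\<lambda>c d. B (a \<cdot> c) (b \<cdot> d)))"
  by (simp add: comult_mult tensor_sum_mult)

text \<open>\<Delta> need not be unital, so \<Delta>(1) cannot simply be dropped; writing x as x 1
  lets it be absorbed on the right of \<Delta>(x).\<close>

lemma sw_mult_one:
  "cbilinear B \<Longrightarrow> sw x B = sw x (\<lambda>a b. sw \<^bold>1 (\<lambda>c d. B (a \<cdot> c) (b \<cdot> d)))"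
  using sw_mult[of B x "\<^bold>1"] by (simp add: one_right)

lemma sw_antipode: "cbilinear B \<Longrightarrow> sw (S x) B = sw x (\<lambda>a b. B (S b) (S a))"
  unfolding antipode_comult
  by (simp add: tensor_sum_flip tensor_sum_map antipode_linear cbilinear_iff)

lemma sw_coassoc:
  assumes T: "\<And>y z. clinear (\<lambda>x. T x y z)" "\<And>x z. clinear (\<lambda>y. T x y z)" "\<And>x y. clinear (\<lambda>z. T x y z)"
  shows "sw x (\<lambda>a b. sw a (\<lambda>c d. T c d b)) = sw x (\<lambda>a b. sw b (\<lambda>c d. T a c d))"
proof -
  have "sw x (\<lambda>a b. sw a (\<lambda>c d. T c d b)) =
      tensor_sum (tensor_map (comult K) id (comult K x)) (\<lambda>s z. tensor_sum s (\<lambda>x y. T x y z))"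
    using T by (subst tensor_sum_map)
      (auto intro!: cbilinearI clin clinear_tensor_sum_arg simp: comult_linear clinear_id)
  also have "\<dots> = tensor_sum (tensor_map id (comult K) (comult K x)) (\<lambda>x s. tensor_sum s (T x))"
    unfolding coassoc[symmetric] using T by (rule tensor_sum_assoc[symmetric])
  also have "\<dots> = sw x (\<lambda>a b. sw b (\<lambda>c d. T a c d))"
    using T by (subst tensor_sum_map)
      (auto intro!: cbilinearI clin clinear_tensor_sum_arg simp: comult_linear clinear_id)
  finally show ?thesis .
qed

lemma sw_counit_left: "sw x (\<lambda>a b. \<epsilon> a *\<^sub>C b) = x"
  and sw_counit_right: "sw x (\<lambda>a b. \<epsilon> b *\<^sub>C a) = x"
proof -
  have "cbilinear (\<lambda>a b. \<epsilon> a *\<^sub>C b)" "cbilinear (\<lambda>a b. \<epsilon> b *\<^sub>C a)"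
    by (intro cbilinearI clin)+
  note lift = this[THEN tensor_sum_lift]
  show "sw x (\<lambda>a b. \<epsilon> a *\<^sub>C b) = x"
    using counit_left[of x] unfolding slice_left_def lift .
  show "sw x (\<lambda>a b. \<epsilon> b *\<^sub>C a) = x"
    using counit_right[of x] unfolding slice_right_def lift .
qed

section \<open>The axioms for the counital maps in Sweedler form\<close>

lemma slice_right_mult:
  "slice_right \<epsilon> (tensor_mult (alg_mult K) (\<^bold>1 \<otimes>\<^sub>C x) (comult K y)) = sw y (\<lambda>a b. \<epsilon> (x \<cdot> b) *\<^sub>C a)"
proof -
  have 1: "cbilinear (\<lambda>a b. \<epsilon> b *\<^sub>C a)" and 2: "cbilinear (\<lambda>a b. sw y (\<lambda>c d. \<epsilon> (b \<cdot> d) *\<^sub>C (a \<cdot> c)))"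
    by (intro cbilinearI clin)+
  show ?thesis
    by (simp add: slice_right_def tensor_sum_lift[OF 1, symmetric] tensor_sum_mult[OF 1]
        tensor_sum_tensor[OF 2] one_left)
qed

lemma eps_s_sw: "\<epsilon>\<^sub>s x = sw \<^bold>1 (\<lambda>a b. \<epsilon> (x \<cdot> b) *\<^sub>C a)"
  unfolding eps_s_def slice_right_mult ..

lemma eps_t_sw: "\<epsilon>\<^sub>t x = sw \<^bold>1 (\<lambda>a b. \<epsilon> (a \<cdot> x) *\<^sub>C b)"
proof -
  have 1: "cbilinear (\<lambda>a b. \<epsilon> a *\<^sub>C b)"
    by (intro cbilinearI clin)
  have 2: "cbilinear (\<lambda>c d. \<epsilon> (a \<cdot> c) *\<^sub>C (b \<cdot> d))" for a b
    by (intro cbilinearI clin)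
  show ?thesis
    by (simp add: eps_t_def slice_left_def tensor_sum_lift[OF 1, symmetric] tensor_sum_mult[OF 1]
        tensor_sum_tensor[OF 2] one_right)
qed

lemma eps_s_mult_sw: "\<epsilon>\<^sub>s x \<cdot> y = sw y (\<lambda>a b. \<epsilon> (x \<cdot> b) *\<^sub>C a)"
  by (simp only: eps_s_mult slice_right_mult)

lemma eps_s_linear: "clinear \<epsilon>\<^sub>s"
  unfolding eps_s_sw by (intro clin)

lemma eps_t_linear: "clinear \<epsilon>\<^sub>t"
  unfolding eps_t_sw by (intro clin)

lemmas clinear_eps_s [clin] = clinear_compose[OF eps_s_linear]
  and clinear_eps_t [clin] = clinear_compose[OF eps_t_linear]

lemma sw_eps_s_left:
  assumes "cbilinear B"
  shows "sw x (\<lambda>a b. B (\<epsilon>\<^sub>s a) b) = sw \<^bold>1 (\<lambda>a b. B a (x \<cdot> b))"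
proof -
  have 2: "cbilinear (\<lambda>a b. sw \<^bold>1 (\<lambda>c d. B (a \<cdot> c) (b \<cdot> d)))"
    by (intro cbilinearI clin clinear_bilinear[OF assms])
  have "sw x (\<lambda>a b. B (\<epsilon>\<^sub>s a) b) = tensor_sum (tensor_map \<epsilon>\<^sub>s id (comult K x)) B"
    using assms by (simp add: tensor_sum_map eps_s_linear clinear_id)
  also have "\<dots> = sw \<^bold>1 (\<lambda>a b. B a (x \<cdot> b))"
    by (simp add: eps_s_comult tensor_sum_mult assms tensor_sum_tensor[OF 2] one_left)
  finally show ?thesis .
qed

lemma sw_antipode_left: "sw x (\<lambda>a b. S a \<cdot> b) = \<epsilon>\<^sub>s x"
proof -
  show ?thesis
    using antipode_eps_s[of x] cbilinear_mult
    by (simp add: tensor_sum_lift[symmetric] tensor_sum_map antipode_linear clinear_id)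
qed

text \<open>The star is antilinear, so it is applied both inside and outside \<open>B\<close>; the
  summand is then bilinear again and the Sweedler rules apply to it.\<close>

lemma sw_star:
  assumes "cbilinear B"
  shows "sw (alg_star K x) B = alg_star K (sw x (\<lambda>a b. alg_star K (B (alg_star K a) (alg_star K b))))"
proof -
  have anti: "bisemilinear cnj (\<lambda>x y. alg_star K x \<otimes>\<^sub>C alg_star K y)"
    by (simp add: bisemilinear_def star_add star_scaleC clinear_add[OF clinear_tensor_left[OF clinear_ident]]
        clinear_add[OF clinear_tensor_right[OF clinear_ident]] clinear_scale[OF clinear_tensor_left[OF clinear_ident]]
        clinear_scale[OF clinear_tensor_right[OF clinear_ident]])
  have ext: "tensor_star (alg_star K) (abs_tensor f) = free_lift cnj (\<lambda>x y. alg_star K x \<otimes>\<^sub>C alg_star K y) f" for f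
    unfolding tensor_star_def tensor_antilift_def
    by (rule free_lift_respects[OF scalar_hom_cnj anti rep_tensor_rel])
  have add: "tensor_star (alg_star K) (s + t) = tensor_star (alg_star K) s + tensor_star (alg_star K) t" for s t
    by (induction s; induction t)
      (simp add: plus_tensor.abs_eq ext free_lift_add[OF scalar_hom_cnj])
  have "tensor_sum (tensor_star (alg_star K) t) B =
     alg_star K (tensor_sum t (\<lambda>a b. alg_star K (B (alg_star K a) (alg_star K b))))" for t
  proof (induction t rule: tensor_induct)
    case (pure x y)
    have "cbilinear (\<lambda>a b. alg_star K (B (alg_star K a) (alg_star K b)))"
      using assms by (simp add: bisemilinear_def star_add star_scaleC)
    then show ?case
      by (simp add: tensor_sum_tensor tensor_sum_tensor[OF assms] star_star
          tensor_star_def tensor_antilift_tensor[OF anti])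
  next
    case (add s t)
    have "cbilinear (\<lambda>a b. alg_star K (B (alg_star K a) (alg_star K b)))"
      using assms by (simp add: bisemilinear_def star_add star_scaleC)
    from add this show ?case
      by (simp add: \<open>\<And>s t. tensor_star _ (s + t) = _\<close> star_add clinear_add[OF clinear_tensor_sum_arg]
          clinear_add[OF clinear_tensor_sum_arg[OF assms]])
  qed
  then show ?thesis
    by (simp add: comult_star)
qed

text \<open>\<open>S\<close> reverses the legs, so \<open>\<epsilon> \<circ> S\<close> is a right
  counit. It agrees with the left counit \<open>\<epsilon>\<close> because both are the sum of
  \<open>\<epsilon> a * \<epsilon> (S b)\<close> over \<Delta>(x).\<close>

lemma counit_antipode: "\<epsilon> (S x) = \<epsilon> x"
proof -
  have "S (sw x (\<lambda>a b. \<epsilon> (S b) *\<^sub>C a)) = sw (S x) (\<lambda>a b. \<epsilon> a *\<^sub>C b)"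
    by (subst sw_antipode) (auto intro!: cbilinearI clin simp: sw_simps)
  then have "S (S (sw x (\<lambda>a b. \<epsilon> (S b) *\<^sub>C a))) = S (S x)"
    by (simp add: sw_counit_left)
  then have 1: "sw x (\<lambda>a b. \<epsilon> (S b) *\<^sub>C a) = x"
    by (simp add: antipode_antipode)
  have "\<epsilon> (S x) = \<epsilon> (S (sw x (\<lambda>a b. \<epsilon> a *\<^sub>C b)))"
    by (simp add: sw_counit_left)
  also have "\<dots> = \<epsilon> (sw x (\<lambda>a b. \<epsilon> (S b) *\<^sub>C a))"
    by (simp add: sw_simps mult.commute)
  finally show ?thesis
    by (simp add: 1)
qed

lemma antipode_one: "S \<^bold>1 = \<^bold>1"
  by (metis antipode_antipode antipode_mult one_left one_right)

text \<open>\<open>S\<close> fixes unit and counit and reverses products and coproducts, hence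
  exchanges the two counital maps. The target versions \<open>sw_antipode_right\<close>,
  \<open>sw_eps_t_right\<close>, \<open>sw_cartan_t\<close> and \<open>eps_t_cartan\<close> are
  obtained from the source versions in this way.\<close>

lemma antipode_eps_s_eq: "S (\<epsilon>\<^sub>s x) = \<epsilon>\<^sub>t (S x)"
proof -
  have eq: "\<epsilon> (x \<cdot> b) = \<epsilon> (S b \<cdot> S x)" for b
    by (metis antipode_mult counit_antipode)
  have "S (\<epsilon>\<^sub>s x) = sw \<^bold>1 (\<lambda>a b. \<epsilon> (S b \<cdot> S x) *\<^sub>C S a)"
    by (simp add: eps_s_sw sw_simps eq)
  also have "\<dots> = sw (S \<^bold>1) (\<lambda>a b. \<epsilon> (a \<cdot> S x) *\<^sub>C b)"
    by (rule sw_antipode[symmetric]) (intro cbilinearI clin)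
  finally show ?thesis
    by (simp add: eps_t_sw antipode_one)
qed

lemma antipode_eps_t_eq: "S (\<epsilon>\<^sub>t x) = \<epsilon>\<^sub>s (S x)"
  by (metis antipode_antipode antipode_eps_s_eq)

lemma sw_antipode_right: "sw x (\<lambda>a b. a \<cdot> S b) = \<epsilon>\<^sub>t x"
proof -
  have "\<epsilon>\<^sub>t x = S (\<epsilon>\<^sub>s (S x))"
    by (simp add: antipode_eps_s_eq antipode_antipode)
  also have "\<dots> = S (sw (S x) (\<lambda>a b. S a \<cdot> b))"
    by (simp add: sw_antipode_left)
  also have "\<dots> = S (sw x (\<lambda>a b. S (S b) \<cdot> S a))"
    by (subst sw_antipode) (auto intro!: cbilinearI clin)
  finally show ?thesis
    by (simp add: sw_simps antipode_mult antipode_antipode)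
qed

lemma sw_eps_t_right:
  assumes B: "cbilinear B"
  shows "sw x (\<lambda>a b. B a (\<epsilon>\<^sub>t b)) = sw \<^bold>1 (\<lambda>a b. B (a \<cdot> x) b)"
proof -
  have 1: "cbilinear (\<lambda>a b. B (S b) (S a))"
    by (intro cbilinearI clin clinear_bilinear[OF B])
  have "sw x (\<lambda>a b. B a (\<epsilon>\<^sub>t b)) = sw (S (S x)) (\<lambda>a b. B a (\<epsilon>\<^sub>t b))"
    by (simp add: antipode_antipode)
  also have "\<dots> = sw (S x) (\<lambda>a b. B (S b) (S (\<epsilon>\<^sub>s a)))"
    by (subst sw_antipode) (auto intro!: cbilinearI clin clinear_bilinear[OF B] simp: antipode_eps_s_eq)
  also have "\<dots> = sw \<^bold>1 (\<lambda>a b. B (S (S x \<cdot> b)) (S a))"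
    by (rule sw_eps_s_left[OF 1])
  also have "\<dots> = sw \<^bold>1 (\<lambda>a b. B (S b \<cdot> x) (S a))"
    by (simp add: antipode_mult antipode_antipode)
  also have "\<dots> = sw (S \<^bold>1) (\<lambda>a b. B (a \<cdot> x) b)"
    by (rule sw_antipode[symmetric]) (intro cbilinearI clin clinear_bilinear[OF B])
  finally show ?thesis
    by (simp add: antipode_one)
qed

section \<open>The Cartan subalgebras and the coproduct of their elements\<close>

lemma eps_s_one: "\<epsilon>\<^sub>s \<^bold>1 = \<^bold>1" and eps_t_one: "\<epsilon>\<^sub>t \<^bold>1 = \<^bold>1"
  by (simp_all add: eps_s_sw eps_t_sw one_left one_right sw_counit_left sw_counit_right)

text \<open>This is \<Delta>(z) = (1 \<otimes> z) \<Delta>(1). For z =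
  \<open>\<epsilon>\<^sub>s x\<close>, a slice of \<Delta>(1), coassociativity moves the inner
  coproduct to the second leg, where \<open>eps_s_mult_sw\<close> recognises multiplication by
  z.\<close>

lemma sw_cartan_s:
  assumes z: "z \<in> K\<^sub>s" and B: "cbilinear B"
  shows "sw z B = sw \<^bold>1 (\<lambda>a b. B a (z \<cdot> b))"
proof -
  obtain x where x: "z = \<epsilon>\<^sub>s x"
    using z by (auto simp: cartan_s_def)
  have "sw z B = sw \<^bold>1 (\<lambda>a b. \<epsilon> (x \<cdot> b) *\<^sub>C sw a B)"
    unfolding x eps_s_sw
    by (simp add: clinear_tensor_sum[OF clinear_comult] clinear_tensor_sum[OF clinear_tensor_sum_arg[OF B]]
        clinear_tensor_sum[OF comult_linear] clinear_scale[OF comult_linear]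
        clinear_scale[OF clinear_tensor_sum_arg[OF B]])
  also have "\<dots> = sw \<^bold>1 (\<lambda>a b. sw a (\<lambda>c d. \<epsilon> (x \<cdot> b) *\<^sub>C B c d))"
    by (simp add: clinear_tensor_sum[OF clinear_scaleC_right[OF clinear_ident]])
  also have "\<dots> = sw \<^bold>1 (\<lambda>a b. sw b (\<lambda>c d. \<epsilon> (x \<cdot> d) *\<^sub>C B a c))"
    by (rule sw_coassoc) (intro clin clinear_bilinear[OF B])+
  also have "\<dots> = sw \<^bold>1 (\<lambda>a b. B a (\<epsilon>\<^sub>s x \<cdot> b))"
    unfolding eps_s_mult_sw
    by (simp add: clinear_tensor_sum[OF clinear_bilinear(2)[OF B clinear_ident]]
       clinear_scale[OF clinear_bilinear(2)[OF B clinear_ident]])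
  finally show ?thesis
    by (simp add: x)
qed

lemma eps_s_cartan: "z \<in> K\<^sub>s \<Longrightarrow> \<epsilon>\<^sub>s z = z"
proof -
  assume z: "z \<in> K\<^sub>s"
  have "\<epsilon>\<^sub>s z = sw z (\<lambda>a b. \<epsilon> b *\<^sub>C a)"
    unfolding eps_s_sw by (rule sw_cartan_s[OF z, symmetric]) (intro cbilinearI clin)
  then show ?thesis
    by (simp add: sw_counit_right)
qed

lemma eps_s_in_cartan: "\<epsilon>\<^sub>s x \<in> K\<^sub>s" and eps_t_in_cartan: "\<epsilon>\<^sub>t x \<in> K\<^sub>t"
  by (auto simp: cartan_s_def cartan_t_def)

lemma subspace_cartan_s: "complex_vector.subspace K\<^sub>s"
  and subspace_cartan_t: "complex_vector.subspace K\<^sub>t"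
  unfolding cartan_s_def cartan_t_def
  by (intro clinear_subspace_range eps_s_linear eps_t_linear)+

text \<open>Together with \<open>sw_one_eps_t\<close>: the legs of \<Delta>(1) may be taken in
  \<open>K\<^sub>s\<close> and \<open>K\<^sub>t\<close>.\<close>

lemma sw_one_eps_s:
  assumes "cbilinear B" shows "sw \<^bold>1 (\<lambda>a b. B (\<epsilon>\<^sub>s a) b) = sw \<^bold>1 B"
  using sw_eps_s_left[OF assms, of "\<^bold>1"] by (simp add: one_left)

lemma sw_one_eps_t:
  assumes "cbilinear B" shows "sw \<^bold>1 (\<lambda>a b. B a (\<epsilon>\<^sub>t b)) = sw \<^bold>1 B"
  using sw_eps_t_right[OF assms, of "\<^bold>1"] by (simp add: one_right)

lemma sw_one_in_cartan_s:
  assumes "clinear \<phi>" shows "sw \<^bold>1 (\<lambda>a b. \<phi> b *\<^sub>C a) \<in> K\<^sub>s"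
proof -
  have "sw \<^bold>1 (\<lambda>a b. \<phi> b *\<^sub>C a) = sw \<^bold>1 (\<lambda>a b. \<phi> b *\<^sub>C \<epsilon>\<^sub>s a)"
    using assms by (intro sw_one_eps_s[symmetric] cbilinearI clin)
  also have "\<dots> = \<epsilon>\<^sub>s (sw \<^bold>1 (\<lambda>a b. \<phi> b *\<^sub>C a))"
    by (simp add: clinear_tensor_sum[OF eps_s_linear] clinear_scale[OF eps_s_linear])
  finally show ?thesis
    using eps_s_in_cartan by metis
qed

lemma one_in_cartan: "\<^bold>1 \<in> K\<^sub>s" "\<^bold>1 \<in> K\<^sub>t"
  by (metis eps_s_one eps_s_in_cartan) (metis eps_t_one eps_t_in_cartan)

text \<open>The sum of \<open>\<epsilon> (z \<cdot> b) *\<^sub>C a\<close> over \<Delta>(w) has two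
  readings: \<open>\<epsilon>\<^sub>s (z \<cdot> w)\<close> by \<open>sw_cartan_s\<close>, and
  \<open>\<epsilon>\<^sub>s z \<cdot> w\<close> by \<open>eps_s_mult_sw\<close>.\<close>

lemma cartan_s_mult:
  assumes "z \<in> K\<^sub>s" "w \<in> K\<^sub>s" shows "z \<cdot> w \<in> K\<^sub>s"
proof -
  have "\<epsilon>\<^sub>s (z \<cdot> w) = sw w (\<lambda>a b. \<epsilon> (z \<cdot> b) *\<^sub>C a)"
    using assms(2) by (subst sw_cartan_s) (auto intro!: cbilinearI clin simp: eps_s_sw mult_assoc)
  also have "\<dots> = z \<cdot> w"
    by (simp add: eps_s_mult_sw[symmetric] eps_s_cartan assms)
  finally show ?thesis
    using eps_s_in_cartan by metis
qed

lemma star_one: "alg_star K \<^bold>1 = \<^bold>1"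
  by (metis one_left one_right star_mult star_star)

text \<open>Since 1 is self-adjoint, the adjoint of a slice of \<Delta>(1) is again a slice of
  \<Delta>(1). Its functional \<open>?\<phi>\<close> is linear because it conjugates twice.\<close>

lemma cartan_s_star:
  assumes "z \<in> K\<^sub>s" shows "alg_star K z \<in> K\<^sub>s"
proof -
  let ?\<phi> = "\<lambda>b. cnj (\<epsilon> (z \<cdot> alg_star K b))"
  have \<phi>: "clinear ?\<phi>"
    by (simp add: clinear_iff star_add star_scaleC clinear_add[OF mult_linear_right] clinear_add[OF counit_linear]
        clinear_scale[OF mult_linear_right] clinear_scale[OF counit_linear] complex_scaleC)
  have "z = sw (alg_star K \<^bold>1) (\<lambda>a b. \<epsilon> (z \<cdot> b) *\<^sub>C a)"
    using eps_s_sw[of z] eps_s_cartan[OF assms] by (simp add: star_one)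
  also have "\<dots> = alg_star K (sw \<^bold>1 (\<lambda>a b. ?\<phi> b *\<^sub>C a))"
    by (subst sw_star) (auto intro!: cbilinearI clin simp: star_scaleC star_star)
  finally show ?thesis
    using sw_one_in_cartan_s[OF \<phi>] star_star by metis
qed

text \<open>Taking adjoints in the formula for the coproduct of the adjoint of z gives \<Delta>(z) =
  \<Delta>(1) (1 \<otimes> z) beside (1 \<otimes> z) \<Delta>(1). Slicing the first leg with
  \<open>\<epsilon> (a \<cdot> x)\<close> turns the equality into commutation with
  \<open>\<epsilon>\<^sub>t x\<close>.\<close>

lemma cartan_commute:
  assumes z: "z \<in> K\<^sub>s" and y: "y \<in> K\<^sub>t" shows "z \<cdot> y = y \<cdot> z"
proof -
  let ?s = "alg_star K"
  obtain x where x: "y = \<epsilon>\<^sub>t x"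
    using y by (auto simp: cartan_t_def)
  define B where "B = (\<lambda>a b :: 'a. \<epsilon> (a \<cdot> x) *\<^sub>C b)"
  have B: "cbilinear B"
    unfolding B_def by (intro cbilinearI clin)
  have cb: "cbilinear (\<lambda>a b. ?s (B (?s a) (?s b)))"
    using B by (simp add: bisemilinear_def star_add star_scaleC)
  have cb': "cbilinear (\<lambda>a b. B a (b \<cdot> z))"
    by (intro cbilinearI clin clinear_bilinear[OF B])
  have "sw z B = ?s (sw (?s z) (\<lambda>a b. ?s (B (?s a) (?s b))))"
    using sw_star[OF B, of "?s z"] by (simp add: star_star)
  also have "\<dots> = ?s (sw \<^bold>1 (\<lambda>a b. ?s (B (?s a) (?s b \<cdot> z))))"
    by (simp add: sw_cartan_s[OF cartan_s_star[OF z] cb] star_mult star_star)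
  also have "\<dots> = sw \<^bold>1 (\<lambda>a b. B a (b \<cdot> z))"
    using sw_star[OF cb', of "\<^bold>1"] by (simp add: star_one)
  finally have "sw \<^bold>1 (\<lambda>a b. B a (z \<cdot> b)) = sw \<^bold>1 (\<lambda>a b. B a (b \<cdot> z))"
    by (simp add: sw_cartan_s[OF z B])
  then show ?thesis
    by (simp add: B_def x eps_t_sw sw_simps)
qed

text \<open>The second leg of \<Delta>(1) lies in \<open>K\<^sub>t\<close>, so z may be moved past
  it.\<close>

lemma sw_cartan_s':
  assumes z: "z \<in> K\<^sub>s" and B: "cbilinear B"
  shows "sw z B = sw \<^bold>1 (\<lambda>a b. B a (b \<cdot> z))"
proof -
  have cb: "cbilinear (\<lambda>a b. B a (b \<cdot> z))" "cbilinear (\<lambda>a b. B a (z \<cdot> b))"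
    by (intro cbilinearI clin clinear_bilinear[OF B])+
  have "sw z B = sw \<^bold>1 (\<lambda>a b. B a (z \<cdot> \<epsilon>\<^sub>t b))"
    using sw_one_eps_t[OF cb(2)] by (simp add: sw_cartan_s[OF z B])
  also have "\<dots> = sw \<^bold>1 (\<lambda>a b. B a (b \<cdot> z))"
    using sw_one_eps_t[OF cb(1)] by (simp add: cartan_commute[OF z eps_t_in_cartan])
  finally show ?thesis .
qed

lemma antipode_cartan: "z \<in> K\<^sub>s \<Longrightarrow> S z \<in> K\<^sub>t" "y \<in> K\<^sub>t \<Longrightarrow> S y \<in> K\<^sub>s"
  by (auto simp: cartan_s_def cartan_t_def antipode_eps_s_eq antipode_eps_t_eq)

lemma sw_cartan_t:
  assumes y: "y \<in> K\<^sub>t" and B: "cbilinear B"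
  shows "sw y B = sw \<^bold>1 (\<lambda>a b. B (a \<cdot> y) b)" "sw y B = sw \<^bold>1 (\<lambda>a b. B (y \<cdot> a) b)"
proof -
  note z = antipode_cartan(2)[OF y]
  have cb: "cbilinear (\<lambda>a b. B (S b) (S a))" "cbilinear (\<lambda>a b. B (a \<cdot> y) b)" "cbilinear (\<lambda>a b. B (y \<cdot> a) b)"
    by (intro cbilinearI clin clinear_bilinear[OF B])+
  have "sw y B = sw (S y) (\<lambda>a b. B (S b) (S a))"
    using sw_antipode[OF B, of "S y"] by (simp add: antipode_antipode)
  moreover have "sw (S y) (\<lambda>a b. B (S b) (S a)) = sw \<^bold>1 (\<lambda>a b. B (S b \<cdot> y) (S a))"
    using sw_cartan_s[OF z cb(1)] by (simp add: antipode_mult antipode_antipode)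
  moreover have "sw (S y) (\<lambda>a b. B (S b) (S a)) = sw \<^bold>1 (\<lambda>a b. B (y \<cdot> S b) (S a))"
    using sw_cartan_s'[OF z cb(1)] by (simp add: antipode_mult antipode_antipode)
  ultimately show "sw y B = sw \<^bold>1 (\<lambda>a b. B (a \<cdot> y) b)" "sw y B = sw \<^bold>1 (\<lambda>a b. B (y \<cdot> a) b)"
    using sw_antipode[OF cb(2), of "\<^bold>1"] sw_antipode[OF cb(3), of "\<^bold>1"] by (simp_all add: antipode_one)
qed

lemma eps_t_cartan: "y \<in> K\<^sub>t \<Longrightarrow> \<epsilon>\<^sub>t y = y"
  by (metis antipode_antipode antipode_cartan(2) antipode_eps_s_eq eps_s_cartan)

text \<open>\<Delta>(z) = \<Delta>(1) (1 \<otimes> z), and the factor \<Delta>(1) is absorbed by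
  \<Delta>(x).\<close>

lemma sw_mult_cartan_s:
  assumes z: "z \<in> K\<^sub>s" and B: "cbilinear B"
  shows "sw (x \<cdot> z) B = sw x (\<lambda>a b. B a (b \<cdot> z))"
proof -
  have "sw (x \<cdot> z) B = sw x (\<lambda>a b. sw z (\<lambda>c d. B (a \<cdot> c) (b \<cdot> d)))"
    by (rule sw_mult[OF B])
  also have "\<dots> = sw x (\<lambda>a b. sw \<^bold>1 (\<lambda>c d. B (a \<cdot> c) (b \<cdot> d \<cdot> z)))"
    by (subst sw_cartan_s'[OF z]) (auto intro!: cbilinearI clin clinear_bilinear[OF B] simp: mult_assoc)
  also have "\<dots> = sw x (\<lambda>a b. B a (b \<cdot> z))"
    by (rule sw_mult_one[symmetric]) (intro cbilinearI clin clinear_bilinear[OF B])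
  finally show ?thesis .
qed

lemma sw_mult_cartan_t:
  assumes y: "y \<in> K\<^sub>t" and B: "cbilinear B"
  shows "sw (x \<cdot> y) B = sw x (\<lambda>a b. B (a \<cdot> y) b)"
proof -
  have "sw (x \<cdot> y) B = sw x (\<lambda>a b. sw y (\<lambda>c d. B (a \<cdot> c) (b \<cdot> d)))"
    by (rule sw_mult[OF B])
  also have "\<dots> = sw x (\<lambda>a b. sw \<^bold>1 (\<lambda>c d. B (a \<cdot> c \<cdot> y) (b \<cdot> d)))"
    by (subst sw_cartan_t(1)[OF y]) (auto intro!: cbilinearI clin clinear_bilinear[OF B] simp: mult_assoc)
  also have "\<dots> = sw x (\<lambda>a b. B (a \<cdot> y) b)"
    by (rule sw_mult_one[symmetric]) (intro cbilinearI clin clinear_bilinear[OF B])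
  finally show ?thesis .
qed

lemma counit_mult: "\<epsilon> (x \<cdot> y) = \<epsilon> (\<epsilon>\<^sub>s x \<cdot> y)"
proof -
  have "\<epsilon> (x \<cdot> y) = \<epsilon> (x \<cdot> sw y (\<lambda>a b. \<epsilon> a *\<^sub>C b))"
    by (simp add: sw_counit_left)
  then show ?thesis
    by (simp add: eps_s_mult_sw sw_simps mult.commute)
qed

text \<open>In the antipode formula for \<open>\<epsilon>\<^sub>s\<close>, the factor y on the first
  leg of \<Delta>(1) comes out on the left as \<open>S y\<close>.\<close>

lemma eps_s_cartan_t: "y \<in> K\<^sub>t \<Longrightarrow> \<epsilon>\<^sub>s y = S y"
proof -
  assume y: "y \<in> K\<^sub>t"
  have "\<epsilon>\<^sub>s y = sw \<^bold>1 (\<lambda>a b. S (a \<cdot> y) \<cdot> b)"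
    unfolding sw_antipode_left[symmetric]
    by (subst sw_cartan_t(1)[OF y]) (auto intro!: cbilinearI clin)
  also have "\<dots> = S y \<cdot> sw \<^bold>1 (\<lambda>a b. S a \<cdot> b)"
    by (simp add: antipode_mult mult_assoc sw_simps)
  finally show ?thesis
    by (simp add: sw_antipode_left eps_s_one one_right)
qed

end

section \<open>Haar integrals and the trace of two-sided multiplications\<close>

context weak_kac_algebra
begin

text \<open>Both sides equal \<open>\<Delta>(r x\<^sub>1) (1 \<otimes> S(x\<^sub>2))\<close>: once by multiplicativity of \<open>\<Delta>\<close>, once after replacing
  \<open>x\<^sub>1\<close> by \<open>\<epsilon>\<^sub>s(x\<^sub>1)\<close>.\<close>

lemma sw_right_integral:
  assumes r: "\<And>x. r \<cdot> x = r \<cdot> \<epsilon>\<^sub>s x" and B: "cbilinear B"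
  shows "sw r (\<lambda>a b. B (a \<cdot> x) b) = sw r (\<lambda>a b. B a (b \<cdot> S x))"
proof -
  note lin = clin clinear_bilinear[OF B]
  let ?X = "sw x (\<lambda>c d. sw (r \<cdot> c) (\<lambda>a b. B a (b \<cdot> S d)))"
  have "?X = sw x (\<lambda>c d. sw r (\<lambda>a b. sw c (\<lambda>e f. B (a \<cdot> e) (b \<cdot> f \<cdot> S d))))"
    by (subst sw_mult) (intro cbilinearI lin refl)+
  also have "\<dots> = sw r (\<lambda>a b. sw x (\<lambda>c d. sw c (\<lambda>e f. B (a \<cdot> e) (b \<cdot> f \<cdot> S d))))"
    by (rule tensor_sum_swap)
  also have "\<dots> = sw r (\<lambda>a b. sw x (\<lambda>c d. sw d (\<lambda>e f. B (a \<cdot> c) (b \<cdot> e \<cdot> S f))))"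
    by (subst sw_coassoc) (intro lin refl)+
  also have "\<dots> = sw r (\<lambda>a b. sw x (\<lambda>c d. B (a \<cdot> c) (b \<cdot> \<epsilon>\<^sub>t d)))"
    by (simp add: sw_antipode_right[symmetric] sw_simps mult_assoc
        clinear_tensor_sum[OF clinear_bilinear(2)[OF B clinear_ident]])
  also have "\<dots> = sw r (\<lambda>a b. sw \<^bold>1 (\<lambda>c d. B (a \<cdot> (c \<cdot> x)) (b \<cdot> d)))"
    by (subst sw_eps_t_right) (intro cbilinearI lin refl)+
  also have "\<dots> = sw r (\<lambda>a b. B (a \<cdot> x) b)"
    unfolding mult_assoc[symmetric]
    by (rule sw_mult_one[symmetric]) (intro cbilinearI lin)
  finally have 1: "?X = sw r (\<lambda>a b. B (a \<cdot> x) b)" .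

  have "?X = sw x (\<lambda>c d. sw (r \<cdot> \<epsilon>\<^sub>s c) (\<lambda>a b. B a (b \<cdot> S d)))"
    by (subst r) (rule refl)
  also have "\<dots> = sw \<^bold>1 (\<lambda>c d. sw (r \<cdot> c) (\<lambda>a b. B a (b \<cdot> S (x \<cdot> d))))"
    by (rule sw_eps_s_left) (intro cbilinearI lin)
  \<comment> \<open>The first leg of \<Delta>(1) is placed in \<open>K\<^sub>s\<close> so that
    \<open>sw_mult_cartan_s\<close> can carry it to the second leg of \<Delta>(r); afterwards
    \<open>\<epsilon>\<^sub>s\<close> is removed again.\<close>
  also have "\<dots> = sw \<^bold>1 (\<lambda>c d. sw (r \<cdot> \<epsilon>\<^sub>s c) (\<lambda>a b. B a (b \<cdot> S (x \<cdot> d))))"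
    by (rule sw_one_eps_s[symmetric]) (intro cbilinearI lin)
  also have "\<dots> = sw \<^bold>1 (\<lambda>c d. sw r (\<lambda>a b. B a (b \<cdot> \<epsilon>\<^sub>s c \<cdot> S (x \<cdot> d))))"
    by (subst sw_mult_cartan_s) (intro cbilinearI lin refl eps_s_in_cartan)+
  also have "\<dots> = sw \<^bold>1 (\<lambda>c d. sw r (\<lambda>a b. B a (b \<cdot> c \<cdot> S (x \<cdot> d))))"
    by (rule sw_one_eps_s) (intro cbilinearI lin)
  also have "\<dots> = sw r (\<lambda>a b. sw \<^bold>1 (\<lambda>c d. B a (b \<cdot> c \<cdot> S (x \<cdot> d))))"
    by (rule tensor_sum_swap)
  also have "\<dots> = sw r (\<lambda>a b. B a (b \<cdot> sw \<^bold>1 (\<lambda>c d. c \<cdot> S d) \<cdot> S x))"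
    by (simp add: sw_simps mult_assoc antipode_mult
        clinear_tensor_sum[OF clinear_bilinear(2)[OF B clinear_ident]])
  also have "\<dots> = sw r (\<lambda>a b. B a (b \<cdot> S x))"
    by (simp add: sw_antipode_right eps_t_one one_right)
  finally show ?thesis
    using 1 by simp
qed

text \<open>\<open>S q\<close> satisfies the hypothesis of \<open>sw_right_integral\<close>, whose
  conclusion is carried back by \<open>S\<close>.\<close>

lemma sw_left_integral:
  assumes q: "\<And>x. x \<cdot> q = \<epsilon>\<^sub>t x \<cdot> q" and B: "cbilinear B"
  shows "sw q (\<lambda>a b. B (S x \<cdot> a) b) = sw q (\<lambda>a b. B a (x \<cdot> b))"
proof -
  note lin = clin clinear_bilinear[OF B]
  have r: "S q \<cdot> x = S q \<cdot> \<epsilon>\<^sub>s x" for x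
    by (metis antipode_antipode antipode_eps_t_eq antipode_mult q)
  have flip: "sw q C = sw (S q) (\<lambda>a b. C (S b) (S a))" if "cbilinear C"
    for C :: "'a \<Rightarrow> 'a \<Rightarrow> 'b"
    using sw_antipode[OF that, of "S q"] by (simp add: antipode_antipode)
  have "sw q (\<lambda>a b. B (S x \<cdot> a) b) = sw (S q) (\<lambda>a b. B (S x \<cdot> S b) (S a))"
    by (rule flip) (intro cbilinearI lin)
  also have "\<dots> = sw (S q) (\<lambda>a b. B (S (b \<cdot> S (S x))) (S a))"
    by (simp add: antipode_mult antipode_antipode)
  also have "\<dots> = sw (S q) (\<lambda>a b. B (S b) (S (a \<cdot> S x)))"
    by (rule sw_right_integral[OF r, symmetric]) (intro cbilinearI lin)
  also have "\<dots> = sw (S q) (\<lambda>a b. B (S b) (x \<cdot> S a))"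
    by (simp add: antipode_mult antipode_antipode)
  also have "\<dots> = sw q (\<lambda>a b. B a (x \<cdot> b))"
    by (rule flip[symmetric]) (intro cbilinearI lin)
  finally show ?thesis .
qed

end

text \<open>Connectedness of the dual enters as the statement that \<open>K\<^sub>s\<close> and
  \<open>K\<^sub>t\<close> meet only in scalars; \<open>cartan_Int_scalars\<close> supplies
  it.\<close>

locale biconnected_markov = weak_kac_algebra +
  fixes p \<tau> and l :: real
  assumes haar_p: "haar_projection K p" and haar_\<tau>: "haar_trace K \<tau>"
    and l_pos: "0 < l" and markov: "expect_t K \<tau> p = complex_of_real l *\<^sub>C alg_one K"
    and connected: "connected_kac K"
    and cartan_Int: "cartan_s K \<inter> cartan_t K \<subseteq> range (\<lambda>c. c *\<^sub>C alg_one K)"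
begin

section \<open>Haar projection and Haar trace under the Markov condition\<close>

lemma \<tau>_linear: "clinear \<tau>" and \<tau>_commute: "\<tau> (x \<cdot> y) = \<tau> (y \<cdot> x)"
  using haar_\<tau> by (simp_all add: haar_trace_def faithful_trace_def positive_functional_def)

lemmas clinear_\<tau> [clin] = clinear_compose[OF \<tau>_linear]

lemma \<tau>_cartan_s: "z \<in> K\<^sub>s \<Longrightarrow> \<tau> z = \<epsilon> z" and \<tau>_cartan_t: "y \<in> K\<^sub>t \<Longrightarrow> \<tau> y = \<epsilon> y"
  using haar_\<tau> by (metis haar_trace_def eps_s_cartan) (metis haar_trace_def haar_\<tau> eps_t_cartan)

lemma \<tau>_antipode: "z \<in> K\<^sub>s \<Longrightarrow> \<tau> (S z) = \<tau> z"
  by (simp add: \<tau>_cartan_s \<tau>_cartan_t antipode_cartan counit_antipode)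

lemma p_right: "p \<cdot> x = p \<cdot> \<epsilon>\<^sub>s x" and p_left: "x \<cdot> p = \<epsilon>\<^sub>t x \<cdot> p"
  and eps_s_p: "\<epsilon>\<^sub>s p = \<^bold>1"
  using haar_p unfolding haar_projection_def by blast+

lemma cbilinear_slice: "cbilinear (\<lambda>a b. \<tau> b *\<^sub>C a)" "cbilinear (\<lambda>a b. \<tau> a *\<^sub>C b)"
  by (intro cbilinearI clin)+

lemma expect_t_sw: "expect_t K \<tau> x = sw x (\<lambda>a b. \<tau> b *\<^sub>C a)"
  by (simp add: expect_t_def slice_right_def tensor_sum_lift[OF cbilinear_slice(1)])

text \<open>The integral property moves x from the second leg of \<Delta>(p) to the first, where
  \<open>S\<close> brings it out as a left factor. What remains is \<open>S\<close> of the
  expectation of p, which is the scalar \<open>l\<close>.\<close>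

lemma haar_dual_basis: "sw p (\<lambda>a b. \<tau> (b \<cdot> x) *\<^sub>C S a) = complex_of_real l *\<^sub>C x"
proof -
  have "sw p (\<lambda>a b. \<tau> (b \<cdot> S (S x)) *\<^sub>C S a) = sw p (\<lambda>a b. \<tau> b *\<^sub>C S (a \<cdot> S x))"
    by (rule sw_right_integral[OF p_right, symmetric]) (intro cbilinearI clin)
  also have "\<dots> = x \<cdot> S (sw p (\<lambda>a b. \<tau> b *\<^sub>C a))"
    by (simp add: sw_simps antipode_mult antipode_antipode)
  also have "\<dots> = complex_of_real l *\<^sub>C x"
    by (simp add: expect_t_sw[symmetric] markov sw_simps antipode_one one_right)
  finally show ?thesis
    by (simp add: antipode_antipode)
qed

definition haar_average :: "'a \<Rightarrow> 'a" where
  "haar_average x = sw p (\<lambda>a b. b \<cdot> x \<cdot> S a)"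

text \<open>\<open>sw_left_integral\<close> trades a factor c on the second leg of \<Delta>(p) for
  \<open>S c\<close> on the first, and \<open>S\<close> turns this into a factor c on the far
  right.\<close>

lemma haar_average_center: "haar_average x \<in> alg_center K"
proof -
  have "c \<cdot> haar_average x = haar_average x \<cdot> c" for c
  proof -
    have "c \<cdot> haar_average x = sw p (\<lambda>a b. (c \<cdot> b) \<cdot> x \<cdot> S a)"
      by (simp add: haar_average_def sw_simps mult_assoc)
    also have "\<dots> = sw p (\<lambda>a b. b \<cdot> x \<cdot> S (S c \<cdot> a))"
      by (rule sw_left_integral[OF p_left, symmetric]) (intro cbilinearI clin)
    also have "\<dots> = haar_average x \<cdot> c"
      by (simp add: haar_average_def sw_simps mult_assoc antipode_mult antipode_antipode)
    finally show ?thesis .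
  qed
  then show ?thesis
    by (simp add: alg_center_def)
qed

text \<open>Under \<open>S\<close> the average of z becomes
  \<open>\<epsilon>\<^sub>t (p \<cdot> S z)\<close>, since \<open>S z\<close> lies in
  \<open>K\<^sub>t\<close> and can be absorbed into p.\<close>

lemma haar_average_cartan_s:
  assumes z: "z \<in> K\<^sub>s" shows "haar_average z \<in> K\<^sub>s"
proof -
  have "S (haar_average z) = sw p (\<lambda>a b. a \<cdot> S z \<cdot> S b)"
    by (simp add: haar_average_def sw_simps antipode_mult antipode_antipode mult_assoc)
  also have "\<dots> = sw (p \<cdot> S z) (\<lambda>a b. a \<cdot> S b)"
    by (rule sw_mult_cartan_t[symmetric]) (intro antipode_cartan z cbilinearI clin)+
  finally have "S (haar_average z) = \<epsilon>\<^sub>t (p \<cdot> S z)"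
    by (simp add: sw_antipode_right)
  then show ?thesis
    by (metis antipode_antipode antipode_cartan(2) eps_t_in_cartan)
qed

text \<open>By the trace property the legs of \<Delta>(p) meet as \<open>S a \<cdot> b\<close>,
  whose sum is \<open>\<epsilon>\<^sub>s p\<close>, that is 1.\<close>

lemma \<tau>_haar_average: "\<tau> (haar_average x) = \<tau> x"
proof -
  have "\<tau> (b \<cdot> x \<cdot> S a) = \<tau> (x \<cdot> (S a \<cdot> b))" for a b
    by (metis \<tau>_commute mult_assoc)
  then have "\<tau> (haar_average x) = sw p (\<lambda>a b. \<tau> (x \<cdot> (S a \<cdot> b)))"
    by (simp add: haar_average_def clinear_tensor_sum[OF \<tau>_linear])
  also have "\<dots> = \<tau> (x \<cdot> \<epsilon>\<^sub>s p)"
    by (simp add: sw_antipode_left[symmetric] sw_simps clinear_tensor_sum[OF \<tau>_linear])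
  finally show ?thesis
    by (simp add: eps_s_p one_right)
qed

text \<open>The trace of \<open>v \<mapsto> x v y\<close> on \<open>K\<close>, expressed through the dual basis given by \<open>haar_dual_basis\<close>.\<close>

definition LR_trace :: "'a \<Rightarrow> 'a \<Rightarrow> complex" where
  "LR_trace x y = sw p (\<lambda>a b. \<tau> (b \<cdot> (x \<cdot> S a \<cdot> y))) / complex_of_real l"

text \<open>The average of z is central and lies in \<open>K\<^sub>s\<close>, hence is a scalar by
  connectedness; applying \<tau> identifies the scalar.\<close>

lemma LR_trace_cartan_s:
  assumes z: "z \<in> K\<^sub>s" and nz: "\<tau> \<^bold>1 \<noteq> 0"
  shows "LR_trace z x = \<tau> z * \<tau> x / (complex_of_real l * \<tau> \<^bold>1)"
proof -
  have "haar_average z \<in> range (\<lambda>c. c *\<^sub>C \<^bold>1)"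
    using connected haar_average_center haar_average_cartan_s[OF z] unfolding connected_kac_def by blast
  then obtain c where c: "haar_average z = c *\<^sub>C \<^bold>1" by blast
  have "\<tau> z = c * \<tau> \<^bold>1"
    using \<tau>_haar_average[of z] by (simp add: c clinear_scale[OF \<tau>_linear] complex_scaleC)
  then have c': "c = \<tau> z / \<tau> \<^bold>1"
    using nz by simp
  have "LR_trace z x = \<tau> (haar_average z \<cdot> x) / complex_of_real l"
    by (simp add: LR_trace_def haar_average_def sw_simps clinear_tensor_sum[OF \<tau>_linear] mult_assoc)
  then show ?thesis
    by (simp add: c c' sw_simps one_left clinear_scale[OF \<tau>_linear])
qed

text \<open>The slice \<open>?E z\<close> lies in \<open>K\<^sub>s\<close> as a slice of \<Delta>(1)
  and in \<open>K\<^sub>t\<close> by invariance of the Haar trace, so it is a scalar. Factors from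
  \<open>K\<^sub>t\<close> pull out of \<open>?E\<close>, and \<epsilon> after \<open>?E\<close> is
  \<tau>.\<close>

lemma \<tau>_cartan_mult:
  assumes z: "z \<in> K\<^sub>s" and y: "y \<in> K\<^sub>t"
  shows "\<tau> (z \<cdot> y) * \<tau> \<^bold>1 = \<tau> z * \<tau> y"
proof -
  let ?E = "\<lambda>x. sw x (\<lambda>a b. \<tau> b *\<^sub>C a)"
  have \<epsilon>E: "\<epsilon> (?E x) = \<tau> x" for x
  proof -
    have "\<epsilon> (?E x) = \<tau> (sw x (\<lambda>a b. \<epsilon> a *\<^sub>C b))"
      by (simp add: sw_simps clinear_tensor_sum[OF \<tau>_linear] clinear_scale[OF \<tau>_linear] mult.commute)
    then show ?thesis
      by (simp add: sw_counit_left)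
  qed
  have "?E z = sw \<^bold>1 (\<lambda>a b. \<tau> (b \<cdot> z) *\<^sub>C a)"
    by (rule sw_cartan_s'[OF z cbilinear_slice(1)])
  moreover have "\<dots> \<in> K\<^sub>s"
    by (rule sw_one_in_cartan_s) (intro clin)
  moreover have "?E z = sw z (\<lambda>a b. \<tau> b *\<^sub>C \<epsilon>\<^sub>t a)"
  proof -
    have "cbilinear (\<lambda>a b. \<tau> b *\<^sub>C \<epsilon>\<^sub>t a)"
      by (intro cbilinearI clin)
    then show ?thesis
      using haar_\<tau> by (simp add: haar_trace_def tensor_sum_lift[OF cbilinear_slice(1)] tensor_sum_lift slice_right_def)
  qed
  moreover have "\<dots> \<in> K\<^sub>t"
    by (rule tensor_sum_in_subspace[OF subspace_cartan_t])
      (simp add: complex_vector.subspace_scale subspace_cartan_t eps_t_in_cartan)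
  ultimately have "?E z \<in> K\<^sub>s \<inter> K\<^sub>t" by simp
  then obtain c where c: "?E z = c *\<^sub>C \<^bold>1"
    using cartan_Int by blast
  have "\<tau> z = c * \<tau> \<^bold>1"
    using \<epsilon>E[of z] \<tau>_cartan_s[OF one_in_cartan(1)] by (simp add: c sw_simps)
  moreover have "?E (z \<cdot> y) = ?E z \<cdot> y"
    by (simp add: sw_mult_cartan_t[OF y cbilinear_slice(1)] sw_simps)
  then have "\<tau> (z \<cdot> y) = c * \<tau> y"
    using \<epsilon>E[of "z \<cdot> y"] \<tau>_cartan_t[OF y] by (simp add: c sw_simps one_left)
  ultimately show ?thesis by simp
qed

end

section \<open>The dual algebra\<close>

lemma dual_apply_linear: "clinear (dual_apply \<phi>)"
  using dual_apply[of \<phi>] by simp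

lemmas clinear_dual_apply [clin] = clinear_compose[OF dual_apply_linear]

lemma clinear_dual_eval: "clinear (\<lambda>\<phi>. dual_apply \<phi> x)"
  by (simp add: clinear_iff plus_cdual.rep_eq scaleC_cdual.rep_eq complex_scaleC)

lemmas clinear_dual_apply_left [clin] = clinear_compose[OF clinear_dual_eval]

lemma cdual_eqI: "(\<And>x. dual_apply \<phi> x = dual_apply \<psi> x) \<Longrightarrow> \<phi> = \<psi>"
  by (metis dual_apply_inject ext)

lemma dual_apply_Abs: "clinear f \<Longrightarrow> dual_apply (Abs_cdual f) = f"
  by (simp add: Abs_cdual_inverse)

lemma clinear_cdualI:
  "(\<And>x. clinear (\<lambda>y. dual_apply (f y) x)) \<Longrightarrow> clinear f"
  by (auto simp: clinear_iff plus_cdual.rep_eq scaleC_cdual.rep_eq complex_scaleC intro!: cdual_eqI)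

lemma cbilinear_dual_pair: "cbilinear (\<lambda>\<phi> \<psi>. dual_apply \<phi> x * dual_apply \<psi> y)"
  by (intro cbilinearI clin)

lemma dual_pair_sum: "dual_pair T x y = tensor_sum T (\<lambda>\<phi> \<psi>. dual_apply \<phi> x * dual_apply \<psi> y)"
  by (simp add: dual_pair_def tensor_sum_lift cbilinear_dual_pair)

context fd_cstar_algebra
begin

lemma obtain_basis:
  obtains B where "finite B" "complex_vector.independent B" "complex_vector.span B = (UNIV :: 'a set)"
proof -
  obtain B where "finite_dimensional_vector_space (scaleC :: complex \<Rightarrow> 'a \<Rightarrow> 'a) B"
    using finite_dim by blast
  then interpret B: finite_dimensional_vector_space "scaleC :: complex \<Rightarrow> 'a \<Rightarrow> 'a" B .
  show thesis
    using that B.finite_Basis B.independent_Basis B.span_Basis by blast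
qed

lemma dual_basis_exists:
  "\<exists>B (f :: 'a \<Rightarrow> 'a cdual). finite B \<and> (\<forall>x. (\<Sum>b\<in>B. dual_apply (f b) x *\<^sub>C b) = x)"
proof -
  obtain B :: "'a set" where B: "finite B" "complex_vector.independent B" "complex_vector.span B = UNIV"
    by (rule obtain_basis)
  have lin: "clinear (\<lambda>x. complex_vector.representation B x b)" for b
    using B by (simp add: clinear_iff complex_vector.representation_add complex_vector.representation_scale
        complex_scaleC)
  have "(\<Sum>b\<in>B. dual_apply (Abs_cdual (\<lambda>x. complex_vector.representation B x b)) x *\<^sub>C b) = x" for x
    using B by (simp add: dual_apply_Abs[OF lin] complex_vector.sum_representation_eq)
  with B(1) show ?thesis
    by (intro exI[of _ B] exI[of _ "\<lambda>b. Abs_cdual (\<lambda>x. complex_vector.representation B x b)"]) blast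
qed

text \<open>In finite dimension bilinear forms correspond to tensors of functionals. This justifies
  the definite description in the comultiplication of \<open>dual_kac\<close>.\<close>

lemma dual_pair_exists:
  assumes "cbilinear F"
  shows "\<exists>!T. \<forall>x y. dual_pair T x y = F x (y :: 'a)"
proof -
  obtain B and f :: "'a \<Rightarrow> 'a cdual" where B: "finite B" "\<And>x. (\<Sum>b\<in>B. dual_apply (f b) x *\<^sub>C b) = x"
    using dual_basis_exists by blast
  have tens: "dual_pair (\<phi> \<otimes>\<^sub>C \<psi>) x y = dual_apply \<phi> x * dual_apply \<psi> y"
    for \<phi> \<psi> :: "'a cdual" and x y
    by (simp add: dual_pair_sum tensor_sum_tensor cbilinear_dual_pair)
  have lin: "clinear (\<lambda>T. dual_pair T x y)" for x y :: 'a
    unfolding dual_pair_sum by (rule clinear_tensor_sum_arg[OF cbilinear_dual_pair])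
  have Flin: "clinear (F x)" for x
    using assms by (simp add: cbilinear_iff)
  define T where "T = (\<Sum>b\<in>B. f b \<otimes>\<^sub>C Abs_cdual (F b))"
  have T: "dual_pair T x y = F x y" for x y
  proof -
    have "dual_pair T x y = (\<Sum>b\<in>B. dual_apply (f b) x * F b y)"
      by (simp add: T_def clinear_sum[OF lin] tens dual_apply_Abs[OF Flin])
    also have "\<dots> = F (\<Sum>b\<in>B. dual_apply (f b) x *\<^sub>C b) y"
      by (simp add: clinear_sum[OF clinear_bilinear(1)[OF assms clinear_ident]]
          clinear_scale[OF clinear_bilinear(1)[OF assms clinear_ident]] complex_scaleC)
    finally show ?thesis
      by (simp add: B(2))
  qed
  \<comment> \<open>Uniqueness: a tensor is recovered from its values on pairs of basis
    vectors.\<close>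
  have expand: "T' = (\<Sum>b\<in>B. \<Sum>c\<in>B. dual_pair T' b c *\<^sub>C (f b \<otimes>\<^sub>C f c))" for T'
  proof (rule tensor_ext[of "\<lambda>x. x"])
    fix \<phi> \<psi> :: "'a cdual"
    have dual: "\<phi> = (\<Sum>b\<in>B. dual_apply \<phi> b *\<^sub>C f b)" for \<phi>
    proof (rule cdual_eqI)
      fix x
      have "dual_apply \<phi> x = dual_apply \<phi> (\<Sum>b\<in>B. dual_apply (f b) x *\<^sub>C b)"
        by (simp add: B(2))
      then show "dual_apply \<phi> x = dual_apply (\<Sum>b\<in>B. dual_apply \<phi> b *\<^sub>C f b) x"
        by (simp add: clinear_sum[OF dual_apply_linear] clinear_sum[OF clinear_dual_eval]
            clinear_scale[OF dual_apply_linear] clinear_scale[OF clinear_dual_eval] complex_scaleC mult.commute)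
    qed
    have "\<phi> \<otimes>\<^sub>C \<psi> = (\<Sum>b\<in>B. dual_apply \<phi> b *\<^sub>C f b) \<otimes>\<^sub>C (\<Sum>b\<in>B. dual_apply \<psi> b *\<^sub>C f b)"
      by (simp only: dual[symmetric])
    also have "\<dots> = (\<Sum>b\<in>B. \<Sum>c\<in>B. dual_pair (\<phi> \<otimes>\<^sub>C \<psi>) b c *\<^sub>C (f b \<otimes>\<^sub>C f c))"
      by (simp only: clinear_sum[OF clinear_tensor_left[OF clinear_ident]]
          clinear_scale[OF clinear_tensor_left[OF clinear_ident]])
        (simp add: clinear_sum[OF clinear_tensor_right[OF clinear_ident]]
          clinear_scale[OF clinear_tensor_right[OF clinear_ident]] complex_vector.scale_sum_right
          tens scaleC_scaleC)
    finally show "\<phi> \<otimes>\<^sub>C \<psi> = (\<Sum>b\<in>B. \<Sum>c\<in>B. dual_pair (\<phi> \<otimes>\<^sub>C \<psi>) b c *\<^sub>C (f b \<otimes>\<^sub>C f c))" .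
  next
    show "clinear (\<lambda>T'. \<Sum>b\<in>B. \<Sum>c\<in>B. dual_pair T' b c *\<^sub>C (f b \<otimes>\<^sub>C f c))"
      using lin by (simp add: clinear_iff complex_vector.scale_left_distrib sum.distrib
          complex_vector.scale_sum_right complex_scaleC)
  qed (rule clin)
  have "T' = T" if "\<forall>x y. dual_pair T' x y = F x y" for T'
    using expand[of T'] expand[of T] by (simp only: that T)
  with T show ?thesis
    by blast
qed

end

section \<open>The counital map of the dual and the intersection of the Cartan subalgebras\<close>

context weak_kac_algebra
begin

lemma dual_mult_apply:
  "dual_apply (alg_mult (dual_kac K) \<phi> \<psi>) x = sw x (\<lambda>y z. dual_apply \<phi> y * dual_apply \<psi> z)"
proof -
  have cb: "cbilinear (\<lambda>y z. dual_apply \<phi> y * dual_apply \<psi> z)"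
    by (intro cbilinearI clin)
  have "clinear (\<lambda>x. sw x (\<lambda>y z. dual_apply \<phi> y * dual_apply \<psi> z))"
    by (intro clin)
  then show ?thesis
    by (simp add: dual_kac_def tensor_sum_lift[OF cb, symmetric] dual_apply_Abs)
qed

lemma dual_one_apply: "dual_apply (alg_one (dual_kac K)) x = \<epsilon> x"
  by (simp add: dual_kac_def dual_apply_Abs counit_linear)

lemma cbilinear_dual_mult: "cbilinear (alg_mult (dual_kac K))"
  unfolding cbilinear_iff
  by (intro conjI allI clinear_cdualI; simp only: dual_mult_apply; intro clin)

lemma dual_comult_one: "dual_pair (comult (dual_kac K) (alg_one (dual_kac K))) x y = \<epsilon> (x \<cdot> y)"
proof -
  have "cbilinear (\<lambda>x y. \<epsilon> (x \<cdot> y))"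
    by (intro cbilinearI clin)
  from theI'[OF dual_pair_exists[OF this]]
  have "\<forall>x y. dual_pair (THE T. \<forall>x y. dual_pair T x y = \<epsilon> (x \<cdot> y)) x y = \<epsilon> (x \<cdot> y)" .
  then show ?thesis
    by (simp add: dual_kac_def dual_apply_Abs counit_linear)
qed

text \<open>Pairing turns the coproduct of the dual unit into
  \<open>\<epsilon> (x \<cdot> z)\<close>, and a dual product evaluated at 1 into a sum over
  \<Delta>(1). Together they reproduce \<open>eps_s_sw\<close>, so the dual counital map is the
  transpose of \<open>\<epsilon>\<^sub>s\<close>.\<close>

lemma dual_eps_s_apply: "dual_apply (eps_s (dual_kac K) \<phi>) x = dual_apply \<phi> (\<epsilon>\<^sub>s x)"
proof -
  let ?D = "dual_kac K"
  let ?T = "comult ?D (alg_one ?D)"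
  have slice: "cbilinear (\<lambda>\<alpha> \<beta>. dual_apply \<beta> \<^bold>1 *\<^sub>C \<alpha>)"
    by (intro cbilinearI clin)
  have in2: "cbilinear (\<lambda>a b. tensor_sum ?T (\<lambda>c d. dual_apply (alg_mult ?D b d) \<^bold>1 *\<^sub>C alg_mult ?D a c))"
    by (intro cbilinearI clin clinear_bilinear[OF cbilinear_dual_mult])
  have unit: "alg_mult ?D (alg_one ?D) \<alpha> = \<alpha>" for \<alpha>
  proof (rule cdual_eqI)
    fix x
    have "dual_apply (alg_mult ?D (alg_one ?D) \<alpha>) x = dual_apply \<alpha> (sw x (\<lambda>a b. \<epsilon> a *\<^sub>C b))"
      by (simp add: dual_mult_apply dual_one_apply clinear_tensor_sum[OF dual_apply_linear]
          clinear_scale[OF dual_apply_linear] complex_scaleC)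
    then show "dual_apply (alg_mult ?D (alg_one ?D) \<alpha>) x = dual_apply \<alpha> x"
      by (simp add: sw_counit_left)
  qed
  have counit_D: "counit ?D = (\<lambda>\<phi>. dual_apply \<phi> \<^bold>1)"
    by (simp add: dual_kac_def)
  have "eps_s ?D \<phi> = tensor_sum ?T (\<lambda>\<alpha> \<beta>. dual_apply (alg_mult ?D \<phi> \<beta>) \<^bold>1 *\<^sub>C \<alpha>)"
    unfolding eps_s_def slice_right_def counit_D tensor_sum_lift[OF slice, symmetric]
      tensor_sum_tensor_mult[OF cbilinear_dual_mult slice] tensor_sum_tensor[OF in2] unit ..
  then have "dual_apply (eps_s ?D \<phi>) x =
      tensor_sum ?T (\<lambda>\<alpha> \<beta>. sw \<^bold>1 (\<lambda>y z. dual_apply \<phi> y * dual_apply \<beta> z) * dual_apply \<alpha> x)"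
    by (simp add: clinear_tensor_sum[OF clinear_dual_eval] clinear_scale[OF clinear_dual_eval]
        dual_mult_apply complex_scaleC)
  also have "\<dots> = tensor_sum ?T (\<lambda>\<alpha> \<beta>. sw \<^bold>1 (\<lambda>y z. dual_apply \<phi> y * (dual_apply \<alpha> x * dual_apply \<beta> z)))"
    unfolding clinear_tensor_sum[OF clinear_times_left[OF clinear_ident]]
    by (simp add: mult.assoc mult.left_commute mult.commute)
  also have "\<dots> = sw \<^bold>1 (\<lambda>y z. tensor_sum ?T (\<lambda>\<alpha> \<beta>. dual_apply \<phi> y * (dual_apply \<alpha> x * dual_apply \<beta> z)))"
    by (rule tensor_sum_swap)
  also have "\<dots> = sw \<^bold>1 (\<lambda>y z. dual_apply \<phi> y * \<epsilon> (x \<cdot> z))"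
    by (simp add: clinear_tensor_sum[OF clinear_times_right[OF clinear_ident], symmetric]
        dual_pair_sum[symmetric] dual_comult_one)
  also have "\<dots> = dual_apply \<phi> (\<epsilon>\<^sub>s x)"
    by (simp add: eps_s_sw clinear_tensor_sum[OF dual_apply_linear] clinear_scale[OF dual_apply_linear]
        complex_scaleC mult.commute)
  finally show ?thesis .
qed

text \<open>The functional \<open>\<epsilon> (x \<cdot> z)\<close> of x is fixed by the dual
  counital map. It is central because its product with \<psi> in either order is
  \<open>\<psi> (x \<cdot> z)\<close>: z in \<open>K\<^sub>t\<close> may sit on the first leg of
  \<Delta>(x), z in \<open>K\<^sub>s\<close> on the second. So it is a multiple of \<epsilon>, and z
  = \<open>\<epsilon>\<^sub>t z\<close> is the same multiple of 1.\<close>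

lemma cartan_Int_scalars:
  assumes conn: "connected_kac (dual_kac K)" and z: "z \<in> K\<^sub>s" "z \<in> K\<^sub>t"
  shows "z \<in> range (\<lambda>c. c *\<^sub>C \<^bold>1)"
proof -
  let ?D = "dual_kac K"
  define \<phi> where "\<phi> = Abs_cdual (\<lambda>x. \<epsilon> (x \<cdot> z))"
  have "clinear (\<lambda>x. \<epsilon> (x \<cdot> z))"
    by (intro clin)
  then have \<phi>: "dual_apply \<phi> x = \<epsilon> (x \<cdot> z)" for x
    by (simp add: \<phi>_def dual_apply_Abs)
  have "\<phi> = eps_s ?D \<phi>"
    by (rule cdual_eqI) (simp add: dual_eps_s_apply \<phi> counit_mult[symmetric])
  then have "\<phi> \<in> cartan_s ?D"
    unfolding cartan_s_def by blast
  moreover have "alg_mult ?D \<phi> \<psi> = alg_mult ?D \<psi> \<phi>" for \<psi>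
  proof (rule cdual_eqI)
    fix x
    have cb: "cbilinear (\<lambda>a b. \<epsilon> a * dual_apply \<psi> b)" "cbilinear (\<lambda>a b. dual_apply \<psi> a * \<epsilon> b)"
      by (intro cbilinearI clin)+
    have "dual_apply (alg_mult ?D \<phi> \<psi>) x = sw (x \<cdot> z) (\<lambda>a b. \<epsilon> a * dual_apply \<psi> b)"
      by (simp add: dual_mult_apply \<phi> sw_mult_cartan_t[OF z(2) cb(1)])
    also have "\<dots> = dual_apply \<psi> (sw (x \<cdot> z) (\<lambda>a b. \<epsilon> a *\<^sub>C b))"
      by (simp add: clinear_tensor_sum[OF dual_apply_linear] clinear_scale[OF dual_apply_linear] complex_scaleC)
    also have "\<dots> = dual_apply \<psi> (sw (x \<cdot> z) (\<lambda>a b. \<epsilon> b *\<^sub>C a))"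
      by (simp add: sw_counit_left sw_counit_right)
    also have "\<dots> = sw (x \<cdot> z) (\<lambda>a b. dual_apply \<psi> a * \<epsilon> b)"
      by (simp add: clinear_tensor_sum[OF dual_apply_linear] clinear_scale[OF dual_apply_linear] complex_scaleC
          mult.commute)
    also have "\<dots> = dual_apply (alg_mult ?D \<psi> \<phi>) x"
      by (simp add: dual_mult_apply \<phi> sw_mult_cartan_s[OF z(1) cb(2)])
    finally show "dual_apply (alg_mult ?D \<phi> \<psi>) x = dual_apply (alg_mult ?D \<psi> \<phi>) x" .
  qed
  ultimately have "\<phi> \<in> cartan_s ?D \<inter> alg_center ?D"
    by (simp add: alg_center_def)
  then obtain c where c: "\<phi> = c *\<^sub>C alg_one ?D"
    using conn unfolding connected_kac_def by blast
  have \<epsilon>z: "\<epsilon> (x \<cdot> z) = c * \<epsilon> x" for x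
    using \<phi>[of x] by (simp add: c scaleC_cdual.rep_eq dual_one_apply)
  have "z = sw \<^bold>1 (\<lambda>a b. \<epsilon> (a \<cdot> z) *\<^sub>C b)"
    using eps_t_cartan[OF z(2)] by (simp add: eps_t_sw)
  also have "\<dots> = c *\<^sub>C sw \<^bold>1 (\<lambda>a b. \<epsilon> a *\<^sub>C b)"
    by (simp add: \<epsilon>z clinear_tensor_sum[OF clinear_scaleC_right[OF clinear_ident]] scaleC_scaleC)
  finally show ?thesis
    by (simp add: sw_counit_left) blast
qed

end

section \<open>Traces\<close>

text \<open>The vectors \<open>v\<close> need not be independent: \<open>\<phi>\<close> is any choice of linear coordinates on \<open>V\<close>.\<close>

definition frame_on ::
  "'v::complex_vector set \<Rightarrow> 'i set \<Rightarrow> ('i \<Rightarrow> 'v) \<Rightarrow> ('i \<Rightarrow> 'v \<Rightarrow> complex) \<Rightarrow> bool" where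
  "frame_on V I v \<phi> \<longleftrightarrow> finite I \<and> complex_vector.subspace V \<and> v ` I \<subseteq> V \<and>
     (\<forall>i\<in>I. \<forall>x\<in>V. \<forall>y\<in>V. \<phi> i (x + y) = \<phi> i x + \<phi> i y) \<and>
     (\<forall>i\<in>I. \<forall>c. \<forall>x\<in>V. \<phi> i (c *\<^sub>C x) = c * \<phi> i x) \<and>
     (\<forall>x\<in>V. (\<Sum>i\<in>I. \<phi> i x *\<^sub>C v i) = x)"

text \<open>Coordinates of a frame are linear only on \<open>V\<close>, so they are not covered by
  \<open>clinear_sum\<close>.\<close>

lemma functional_on_subspace_sum:
  fixes \<phi> :: "'v::complex_vector \<Rightarrow> complex"
  assumes V: "complex_vector.subspace V"
    and add: "\<And>x y. x \<in> V \<Longrightarrow> y \<in> V \<Longrightarrow> \<phi> (x + y) = \<phi> x + \<phi> y"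
    and scale: "\<And>c x. x \<in> V \<Longrightarrow> \<phi> (c *\<^sub>C x) = c * \<phi> x"
    and g: "\<And>j. j \<in> J \<Longrightarrow> g j \<in> V"
  shows "\<phi> (\<Sum>j\<in>J. c j *\<^sub>C g j) = (\<Sum>j\<in>J. c j * \<phi> (g j))"
  using g
proof (induction J rule: infinite_finite_induct)
  case (insert j J)
  have "c j *\<^sub>C g j \<in> V" "(\<Sum>j\<in>J. c j *\<^sub>C g j) \<in> V"
    using insert.prems V by (auto intro!: complex_vector.subspace_sum complex_vector.subspace_scale)
  with insert show ?case
    by (simp add: add scale)
qed (use scale[OF complex_vector.subspace_0[OF V], of 0] in simp_all)

lemma frame_on_coord_sum:
  assumes "frame_on V I v \<phi>" "i \<in> I" "\<And>j. j \<in> J \<Longrightarrow> g j \<in> V"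
  shows "\<phi> i (\<Sum>j\<in>J. c j *\<^sub>C g j) = (\<Sum>j\<in>J. c j * \<phi> i (g j))"
  by (rule functional_on_subspace_sum[of V]) (use assms in \<open>simp_all add: frame_on_def\<close>)

text \<open>Expanding \<open>F (v i)\<close> in the second frame and \<open>G (w j)\<close> in the
  first gives the same double sum. With \<open>G\<close> the identity and \<open>V = W\<close> this
  is independence of the trace from the frame.\<close>

lemma frame_trace_cyclic:
  assumes V: "frame_on V I v \<phi>" and W: "frame_on W J w \<psi>"
    and F: "clinear F" "F ` V \<subseteq> W" and G: "clinear G" "G ` W \<subseteq> V"
  shows "(\<Sum>i\<in>I. \<phi> i (G (F (v i)))) = (\<Sum>j\<in>J. \<psi> j (F (G (w j))))"
proof -
  have vV: "v i \<in> V" if "i \<in> I" for i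
    using V that by (auto simp: frame_on_def)
  have wW: "w j \<in> W" if "j \<in> J" for j
    using W that by (auto simp: frame_on_def)
  have "\<phi> i (G (F (v i))) = (\<Sum>j\<in>J. \<psi> j (F (v i)) * \<phi> i (G (w j)))" if i: "i \<in> I" for i
  proof -
    have "F (v i) \<in> W"
      using F(2) vV i by blast
    then have "(\<Sum>j\<in>J. \<psi> j (F (v i)) *\<^sub>C w j) = F (v i)"
      using W unfolding frame_on_def by blast
    then have "G (F (v i)) = G (\<Sum>j\<in>J. \<psi> j (F (v i)) *\<^sub>C w j)"
      by simp
    also have "\<dots> = (\<Sum>j\<in>J. \<psi> j (F (v i)) *\<^sub>C G (w j))"
      by (simp add: clinear_sum[OF G(1)] clinear_scale[OF G(1)])
    finally have "\<phi> i (G (F (v i))) = \<phi> i (\<Sum>j\<in>J. \<psi> j (F (v i)) *\<^sub>C G (w j))"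
      by (rule arg_cong)
    also have "\<dots> = (\<Sum>j\<in>J. \<psi> j (F (v i)) * \<phi> i (G (w j)))"
      by (rule frame_on_coord_sum[OF V i]) (use G(2) wW in blast)
    finally show ?thesis .
  qed
  moreover have "\<psi> j (F (G (w j))) = (\<Sum>i\<in>I. \<phi> i (G (w j)) * \<psi> j (F (v i)))" if j: "j \<in> J" for j
  proof -
    have "G (w j) \<in> V"
      using G(2) wW j by blast
    then have "(\<Sum>i\<in>I. \<phi> i (G (w j)) *\<^sub>C v i) = G (w j)"
      using V unfolding frame_on_def by blast
    then have "F (G (w j)) = F (\<Sum>i\<in>I. \<phi> i (G (w j)) *\<^sub>C v i)"
      by simp
    also have "\<dots> = (\<Sum>i\<in>I. \<phi> i (G (w j)) *\<^sub>C F (v i))"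
      by (simp add: clinear_sum[OF F(1)] clinear_scale[OF F(1)])
    finally have "\<psi> j (F (G (w j))) = \<psi> j (\<Sum>i\<in>I. \<phi> i (G (w j)) *\<^sub>C F (v i))"
      by (rule arg_cong)
    also have "\<dots> = (\<Sum>i\<in>I. \<phi> i (G (w j)) * \<psi> j (F (v i)))"
      by (rule frame_on_coord_sum[OF W j]) (use F(2) vV in blast)
    finally show ?thesis .
  qed
  ultimately show ?thesis
    by (simp add: sum.swap[of _ J I] mult.commute)
qed

lemma frame_on_basis:
  assumes V: "complex_vector.subspace V" and B: "finite B" "complex_vector.independent B" "B \<subseteq> V" "V \<subseteq> complex_vector.span B"
  shows "frame_on V B (\<lambda>b. b) (\<lambda>b x. complex_vector.representation B x b)"
proof -
  have "x \<in> complex_vector.span B" if "x \<in> V" for x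
    using B(4) that by blast
  then show ?thesis
    unfolding frame_on_def
    by (simp add: V B(1,2,3) complex_vector.representation_add complex_vector.representation_scale
        complex_vector.sum_representation_eq)
qed

text \<open>Cyclicity, with the inclusion of \<open>V\<close> as second map, moves the trace to a
  basis of \<open>V\<close>, where \<open>F\<close> is the identity.\<close>

lemma frame_trace_projection:
  assumes W: "frame_on W J w \<psi>" and V: "complex_vector.subspace V" "V \<subseteq> W"
    and F: "clinear F" "F ` W \<subseteq> V" "\<And>x. x \<in> V \<Longrightarrow> F x = x"
  shows "(\<Sum>j\<in>J. \<psi> j (F (w j))) = of_nat (complex_vector.dim V)"
proof -
  obtain B where B: "B \<subseteq> V" "complex_vector.independent B" "V \<subseteq> complex_vector.span B"
      "card B = complex_vector.dim V"
    using complex_vector.basis_exists by blast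
  have "W \<subseteq> complex_vector.span (w ` J)"
  proof
    fix x assume "x \<in> W"
    then have "(\<Sum>j\<in>J. \<psi> j x *\<^sub>C w j) = x"
      using W by (simp add: frame_on_def)
    moreover have "(\<Sum>j\<in>J. \<psi> j x *\<^sub>C w j) \<in> complex_vector.span (w ` J)"
      by (intro complex_vector.span_sum complex_vector.span_scale complex_vector.span_base imageI)
    ultimately show "x \<in> complex_vector.span (w ` J)" by simp
  qed
  moreover have "finite (w ` J)"
    using W by (simp add: frame_on_def)
  ultimately have fin: "finite B"
    using complex_vector.independent_span_bound B(1,2) V(2) by blast
  note frame = frame_on_basis[OF V(1) fin B(2,1,3)]
  have "(\<Sum>j\<in>J. \<psi> j (F (w j))) = (\<Sum>b\<in>B. complex_vector.representation B (F b) b)"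
    by (rule frame_trace_cyclic[OF W frame F(1,2) clinear_ident]) (use V(2) in auto)
  also have "\<dots> = (\<Sum>b\<in>B. 1)"
  proof (rule sum.cong[OF refl])
    fix b assume b: "b \<in> B"
    then have "F b = b"
      using B(1) F(3) by blast
    then show "complex_vector.representation B (F b) b = 1"
      using complex_vector.representation_basis[OF B(2) b] by simp
  qed
  finally show ?thesis
    by (simp add: B(4))
qed

lemma frame_trace_dim:
  assumes V: "frame_on V I v \<phi>"
  shows "(\<Sum>i\<in>I. \<phi> i (v i)) = of_nat (complex_vector.dim V)"
  using frame_trace_projection[OF V, of V "\<lambda>x. x"] V by (simp add: frame_on_def clinear_ident)

lemma frame_trace_idempotent:
  assumes W: "frame_on UNIV I v \<phi>" and F: "clinear F" "\<And>x. F (F x) = F x"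
  shows "(\<Sum>i\<in>I. \<phi> i (F (v i))) \<in> \<nat>"
proof -
  have "(\<Sum>i\<in>I. \<phi> i (F (v i))) = of_nat (complex_vector.dim (range F))"
    by (rule frame_trace_projection[OF W]) (auto simp: F clinear_subspace_range)
  then show ?thesis
    by simp
qed

section \<open>Integrality\<close>

text \<open>Let k = a / b in lowest terms, so b N m = a m. If b^t divides all entries of m, dividing
  by it shows that b divides a times each quotient, hence each quotient; so every power of b divides
  every entry. A positive entry forces b = 1.\<close>

lemma eigenvalue_nat:
  fixes N :: "'i \<Rightarrow> 'i \<Rightarrow> nat" and m :: "'i \<Rightarrow> nat" and k :: real
  assumes eig: "\<And>i. i \<in> I \<Longrightarrow> (\<Sum>j\<in>I. real (N i j * m j)) = k * real (m i)"
    and i0: "i0 \<in> I" "0 < m i0"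
  shows "k \<in> \<nat>"
proof -
  have k: "k = real (\<Sum>j\<in>I. N i0 j * m j) / real (m i0)"
    using eig[OF i0(1)] i0(2) by (simp add: field_simps)
  then have "k \<in> \<rat>" "0 \<le> k"
    by (simp_all del: of_nat_sum)
  then obtain a b :: nat where b: "b \<noteq> 0" and ab: "k = real a / real b" and cop: "coprime a b"
    using Rats_abs_nat_div_natE by (metis abs_of_nonneg)
  have eig': "b * (\<Sum>j\<in>I. N i j * m j) = a * m i" if "i \<in> I" for i
  proof -
    have "real (b * (\<Sum>j\<in>I. N i j * m j)) = real b * (k * real (m i))"
      using eig[OF that] by simp
    also have "\<dots> = real (a * m i)"
      using b by (simp add: ab)
    finally show ?thesis
      by (simp only: of_nat_eq_iff)
  qed
  have pow: "b ^ t dvd m i" if "i \<in> I" for t i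
    using that
  proof (induction t arbitrary: i)
    case (Suc t)
    define m' where "m' j = m j div b ^ t" for j
    have m': "m j = b ^ t * m' j" if "j \<in> I" for j
      using Suc.IH[OF that] by (simp add: m'_def)
    have "b ^ t * (b * (\<Sum>j\<in>I. N i j * m' j)) = b * (\<Sum>j\<in>I. N i j * m j)"
      by (simp add: m' sum_distrib_left mult.left_commute)
    also have "\<dots> = b ^ t * (a * m' i)"
      using eig'[OF Suc.prems] m'[OF Suc.prems] by (simp add: mult.left_commute)
    finally have "b * (\<Sum>j\<in>I. N i j * m' j) = a * m' i"
      using b by simp
    then have "b dvd a * m' i"
      by (metis dvd_triv_left)
    then have "b dvd m' i"
      using cop by (simp add: coprime_commute coprime_dvd_mult_right_iff)
    then show ?case
      unfolding m'[OF Suc.prems] by simp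
  qed simp
  have "b = 1"
  proof (rule ccontr)
    assume "b \<noteq> 1"
    then have "2 \<le> b"
      using b by simp
    \<comment> \<open>The exponent \<open>m i0\<close> is large enough for the power of b to exceed
      \<open>m i0\<close>, which it should divide.\<close>
    then have "2 ^ m i0 \<le> b ^ m i0"
      by (rule power_mono) simp
    moreover have "m i0 < 2 ^ m i0" by simp
    moreover have "b ^ m i0 \<le> m i0"
      by (rule dvd_imp_le[OF pow[OF i0(1)] i0(2)])
    ultimately show False by linarith
  qed
  then show ?thesis
    by (simp add: ab)
qed

section \<open>Two-sided multiplications on the algebra and the regular representation of
  \<open>K\<^sub>s\<close>\<close>

context biconnected_markov
begin

lemma clinear_LR_trace: "clinear (\<lambda>x. LR_trace x y)"
  unfolding LR_trace_def divide_inverse by (intro clin)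

text \<open>By \<open>haar_dual_basis\<close> the vectors \<open>S a\<close>, with coordinates
  \<open>\<tau> (b \<cdot> x) / l\<close>, form a frame indexed by the terms of \<Delta>(p). Hence
  \<open>LR_trace\<close> obeys the general trace lemmas.\<close>

lemma LR_trace_frame:
  "\<exists>(I :: nat set) v \<phi>. frame_on UNIV I v \<phi> \<and> (\<forall>x y. LR_trace x y = (\<Sum>i\<in>I. \<phi> i (x \<cdot> v i \<cdot> y)))"
proof (intro exI conjI allI)
  let ?ts = "tensor_terms (comult K p)"
  let ?v = "\<lambda>i. S (fst (?ts ! i))"
  let ?\<phi> = "\<lambda>i x. \<tau> (snd (?ts ! i) \<cdot> x) / complex_of_real l"
  have "(\<Sum>i<length ?ts. ?\<phi> i x *\<^sub>C ?v i) = x" for x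
  proof -
    have "(\<Sum>i<length ?ts. ?\<phi> i x *\<^sub>C ?v i) =
        inverse (complex_of_real l) *\<^sub>C sw p (\<lambda>a b. \<tau> (b \<cdot> x) *\<^sub>C S a)"
      by (simp add: tensor_sum_def complex_vector.scale_sum_right scaleC_scaleC divide_inverse mult.commute)
    then show ?thesis
      using l_pos by (simp add: haar_dual_basis scaleC_scaleC scaleC_one)
  qed
  then show "frame_on UNIV {..<length ?ts} ?v ?\<phi>"
    by (simp add: frame_on_def complex_vector.subspace_UNIV clinear_add[OF mult_linear_right] clinear_add[OF \<tau>_linear]
        clinear_scale[OF mult_linear_right] clinear_scale[OF \<tau>_linear] complex_scaleC add_divide_distrib)
  show "LR_trace x y = (\<Sum>i<length ?ts. ?\<phi> i (x \<cdot> ?v i \<cdot> y))" for x y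
    by (simp add: LR_trace_def tensor_sum_def sum_divide_distrib)
qed

lemma LR_trace_idempotent:
  assumes "e \<cdot> e = e" "f \<cdot> f = f" shows "LR_trace e f \<in> \<nat>"
proof -
  obtain I :: "nat set" and v \<phi> where frame: "frame_on UNIV I v \<phi>"
      and tr: "\<And>x y. LR_trace x y = (\<Sum>i\<in>I. \<phi> i (x \<cdot> v i \<cdot> y))"
    using LR_trace_frame by blast
  have "e \<cdot> (e \<cdot> x \<cdot> f) \<cdot> f = e \<cdot> x \<cdot> f" for x
    by (metis assms mult_assoc)
  moreover have "clinear (\<lambda>x. e \<cdot> x \<cdot> f)"
    by (intro clin)
  ultimately show ?thesis
    unfolding tr by (intro frame_trace_idempotent[OF frame])
qed

text \<open>Cyclicity for left multiplication by y and the map sending u to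
  \<open>x \<cdot> u \<cdot> b\<close>.\<close>

lemma LR_trace_commute: "LR_trace (x \<cdot> y) b = LR_trace (y \<cdot> x) b"
proof -
  obtain I :: "nat set" and v \<phi> where frame: "frame_on UNIV I v \<phi>"
      and tr: "\<And>x y. LR_trace x y = (\<Sum>i\<in>I. \<phi> i (x \<cdot> v i \<cdot> y))"
    using LR_trace_frame by blast
  have "clinear (\<lambda>u. y \<cdot> u)" "clinear (\<lambda>u. x \<cdot> u \<cdot> b)"
    by (intro clin)+
  from frame_trace_cyclic[OF frame frame this(1) _ this(2)]
  show ?thesis
    by (simp add: tr mult_assoc)
qed

lemma cartan_s_frame:
  "\<exists>(I :: nat set) v \<phi>. frame_on K\<^sub>s I v \<phi> \<and> (\<forall>w\<in>K\<^sub>s. (\<Sum>i\<in>I. \<phi> i (w \<cdot> v i)) = \<tau> w)"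
proof (intro exI conjI ballI)
  let ?ts = "tensor_terms (comult K \<^bold>1)"
  let ?v = "\<lambda>i. \<epsilon>\<^sub>s (fst (?ts ! i))"
  let ?\<phi> = "\<lambda>i x. \<epsilon> (snd (?ts ! i) \<cdot> x)"
  have cb: "cbilinear (\<lambda>a b. \<epsilon> b *\<^sub>C a)" "cbilinear (\<lambda>a b. \<epsilon> (b \<cdot> x) *\<^sub>C a)" for x
    by (intro cbilinearI clin)+
  have "(\<Sum>i<length ?ts. ?\<phi> i x *\<^sub>C ?v i) = x" if "x \<in> K\<^sub>s" for x
  proof -
    have "(\<Sum>i<length ?ts. ?\<phi> i x *\<^sub>C ?v i) = sw \<^bold>1 (\<lambda>a b. \<epsilon> (b \<cdot> x) *\<^sub>C \<epsilon>\<^sub>s a)"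
      by (simp add: tensor_sum_def)
    also have "\<dots> = sw x (\<lambda>a b. \<epsilon> b *\<^sub>C a)"
      using sw_one_eps_s[OF cb(2)] sw_cartan_s'[OF that cb(1)] by simp
    finally show ?thesis
      by (simp add: sw_counit_right)
  qed
  then show "frame_on K\<^sub>s {..<length ?ts} ?v ?\<phi>"
    by (auto simp: frame_on_def subspace_cartan_s eps_s_in_cartan clinear_add[OF mult_linear_right]
        clinear_add[OF counit_linear] clinear_scale[OF mult_linear_right] clinear_scale[OF counit_linear] complex_scaleC)
  fix w assume w: "w \<in> K\<^sub>s"
  have cb1: "cbilinear (\<lambda>a b. \<epsilon> (b \<cdot> (w \<cdot> \<epsilon>\<^sub>s a)))" and cb2: "cbilinear (\<lambda>a b. \<tau> (w \<cdot> (a \<cdot> S (\<epsilon>\<^sub>t b))))"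
    and cb3: "cbilinear (\<lambda>a b. \<tau> (w \<cdot> (a \<cdot> S b)))"
    by (intro cbilinearI clin)+
  \<comment> \<open>\<open>S\<close> carries the factor from \<open>K\<^sub>t\<close> into
    \<open>K\<^sub>s\<close>; there \<epsilon> equals \<tau>, which may be permuted
    cyclically.\<close>
  have eq: "\<epsilon> (\<epsilon>\<^sub>t b \<cdot> (w \<cdot> \<epsilon>\<^sub>s a)) = \<tau> (w \<cdot> (\<epsilon>\<^sub>s a \<cdot> S (\<epsilon>\<^sub>t b)))" for a b
  proof -
    have "\<epsilon> (\<epsilon>\<^sub>t b \<cdot> (w \<cdot> \<epsilon>\<^sub>s a)) = \<epsilon> (S (\<epsilon>\<^sub>t b) \<cdot> (w \<cdot> \<epsilon>\<^sub>s a))"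
      by (simp add: counit_mult[of "\<epsilon>\<^sub>t b"] eps_s_cartan_t eps_t_in_cartan)
    also have "\<dots> = \<tau> (S (\<epsilon>\<^sub>t b) \<cdot> (w \<cdot> \<epsilon>\<^sub>s a))"
      by (rule \<tau>_cartan_s[symmetric]) (intro cartan_s_mult antipode_cartan w eps_s_in_cartan eps_t_in_cartan)
    also have "\<dots> = \<tau> (w \<cdot> (\<epsilon>\<^sub>s a \<cdot> S (\<epsilon>\<^sub>t b)))"
      by (metis \<tau>_commute mult_assoc)
    finally show ?thesis .
  qed
  have "(\<Sum>i<length ?ts. ?\<phi> i (w \<cdot> ?v i)) = sw \<^bold>1 (\<lambda>a b. \<epsilon> (b \<cdot> (w \<cdot> \<epsilon>\<^sub>s a)))"
    by (simp add: tensor_sum_def)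
  also have "\<dots> = sw \<^bold>1 (\<lambda>a b. \<tau> (w \<cdot> (\<epsilon>\<^sub>s a \<cdot> S (\<epsilon>\<^sub>t b))))"
    using sw_one_eps_t[OF cb1] by (simp add: eq)
  also have "\<dots> = sw \<^bold>1 (\<lambda>a b. \<tau> (w \<cdot> (a \<cdot> S b)))"
    using sw_one_eps_s[OF cb2] sw_one_eps_t[OF cb3] by simp
  also have "\<dots> = \<tau> (w \<cdot> \<epsilon>\<^sub>t \<^bold>1)"
    by (simp add: sw_antipode_right[symmetric] sw_simps clinear_tensor_sum[OF \<tau>_linear])
  finally show "(\<Sum>i<length ?ts. ?\<phi> i (w \<cdot> ?v i)) = \<tau> w"
    by (simp add: eps_t_one one_right)
qed

lemma \<tau>_cartan_s_trace:
  assumes frame: "frame_on K\<^sub>s J u \<psi>" and w: "w \<in> K\<^sub>s"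
  shows "\<tau> w = (\<Sum>j\<in>J. \<psi> j (w \<cdot> u j))"
proof -
  obtain I :: "nat set" and v \<phi> where frame': "frame_on K\<^sub>s I v \<phi>"
      and tr: "\<forall>w\<in>K\<^sub>s. (\<Sum>i\<in>I. \<phi> i (w \<cdot> v i)) = \<tau> w"
    using cartan_s_frame by blast
  have "(\<Sum>i\<in>I. \<phi> i (w \<cdot> v i)) = (\<Sum>j\<in>J. \<psi> j (w \<cdot> u j))"
    by (rule frame_trace_cyclic[OF frame' frame mult_linear_right _ clinear_ident])
      (use cartan_s_mult w in auto)
  then show ?thesis
    using tr w by simp
qed

lemma \<tau>_one: "\<tau> \<^bold>1 = of_nat (complex_vector.dim K\<^sub>s)"
proof -
  obtain I :: "nat set" and v \<phi> where frame: "frame_on K\<^sub>s I v \<phi>"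
    using cartan_s_frame by blast
  show ?thesis
    using \<tau>_cartan_s_trace[OF frame one_in_cartan(1)] frame_trace_dim[OF frame]
    by (simp add: one_left)
qed

end

section \<open>Matrix units of a direct sum of matrix algebras\<close>

definition unit_indices :: "nat \<Rightarrow> (nat \<Rightarrow> nat) \<Rightarrow> (nat \<times> nat \<times> nat) set" where
  "unit_indices L m = (SIGMA \<alpha>:{1..L}. {..<m \<alpha>} \<times> {..<m \<alpha>})"

text \<open>Trades the isomorphism for its entry functionals \<open>c\<close> and the preimages
  \<open>E\<close> of the matrix units, so that later arguments stay inside the algebra.\<close>

lemma iso_matrix_sum_units:
  assumes iso: "iso_matrix_sum A B L m" and sub: "complex_vector.subspace B"
  shows "\<exists>E c. frame_on B (unit_indices L m) E c \<and>
    (\<forall>s\<in>unit_indices L m. \<forall>t\<in>unit_indices L m. c s (E t) = (if s = t then 1 else 0)) \<and>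
    (\<forall>\<alpha> i j. (\<alpha>, i, j) \<in> unit_indices L m \<longrightarrow> (\<forall>x\<in>B. \<forall>y\<in>B.
       c (\<alpha>, i, j) (alg_mult A x y) = (\<Sum>k<m \<alpha>. c (\<alpha>, i, k) x * c (\<alpha>, k, j) y)))"
proof -
  let ?P = "\<Pi>\<^sub>E \<alpha>\<in>{1..L}. carrier_mat (m \<alpha>) (m \<alpha>) :: complex mat set"
  obtain f where bij: "bij_betw f B ?P"
    and f_add: "\<And>\<alpha> x y. \<alpha> \<in> {1..L} \<Longrightarrow> x \<in> B \<Longrightarrow> y \<in> B \<Longrightarrow> f (x + y) \<alpha> = f x \<alpha> + f y \<alpha>"
    and f_scale: "\<And>\<alpha> c x. \<alpha> \<in> {1..L} \<Longrightarrow> x \<in> B \<Longrightarrow> f (c *\<^sub>C x) \<alpha> = c \<cdot>\<^sub>m f x \<alpha>"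
    and f_mult: "\<And>\<alpha> x y. \<alpha> \<in> {1..L} \<Longrightarrow> x \<in> B \<Longrightarrow> y \<in> B \<Longrightarrow> f (alg_mult A x y) \<alpha> = f x \<alpha> * f y \<alpha>"
    using iso unfolding iso_matrix_sum_def by blast
  have fP: "f x \<in> ?P" if "x \<in> B" for x
    using bij that by (auto simp: bij_betw_def)
  have carrier: "f x \<alpha> \<in> carrier_mat (m \<alpha>) (m \<alpha>)" if "x \<in> B" "\<alpha> \<in> {1..L}" for x \<alpha>
    using fP[OF that(1)] that(2) by (auto simp: PiE_def Pi_def)
  define c where "c = (\<lambda>(\<alpha>, i, j) x. f x \<alpha> $$ (i, j))"
  \<comment> \<open>Restricted to \<open>{1..L}\<close>, since the bijection is onto extensional
    families.\<close>
  define M where "M t = (\<lambda>\<gamma>\<in>{1..L}. mat (m \<gamma>) (m \<gamma>) (\<lambda>(r, s). if (\<gamma>, r, s) = t then 1 else (0 :: complex)))"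
    for t
  define E where "E t = inv_into B f (M t)" for t
  have MP: "M t \<in> ?P" for t
    by (auto simp: M_def)
  have fE: "f (E t) = M t" and EB: "E t \<in> B" for t
    using MP bij unfolding E_def bij_betw_def by (metis f_inv_into_f) (metis MP bij bij_betw_def inv_into_into)
  have add: "c t (x + y) = c t x + c t y" and scale: "c t (a *\<^sub>C x) = a * c t x"
    if xy: "t \<in> unit_indices L m" "x \<in> B" "y \<in> B" for t x y a
  proof -
    obtain \<alpha> i j where t: "t = (\<alpha>, i, j)" "\<alpha> \<in> {1..L}" "i < m \<alpha>" "j < m \<alpha>"
      using xy(1) by (auto simp: unit_indices_def)
    show "c t (x + y) = c t x + c t y" "c t (a *\<^sub>C x) = a * c t x"
      using carrier[OF xy(2) t(2)] carrier[OF xy(3) t(2)] t xy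
      by (simp_all add: c_def f_add f_scale)
  qed
  have delta: "c s (E t) = (if s = t then 1 else 0)" if "s \<in> unit_indices L m" for s t
    using that by (auto simp: c_def fE M_def unit_indices_def)
  have inj: "x = y" if x: "x \<in> B" and y: "y \<in> B" and eq: "\<And>t. t \<in> unit_indices L m \<Longrightarrow> c t x = c t y" for x y
  proof -
    have "f x \<alpha> = f y \<alpha>" if \<alpha>: "\<alpha> \<in> {1..L}" for \<alpha>
    proof (rule eq_matI)
      fix i j assume "i < dim_row (f y \<alpha>)" "j < dim_col (f y \<alpha>)"
      then have "(\<alpha>, i, j) \<in> unit_indices L m"
        using carrier[OF y \<alpha>] \<alpha> by (simp add: unit_indices_def)
      from eq[OF this] show "f x \<alpha> $$ (i, j) = f y \<alpha> $$ (i, j)"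
        by (simp add: c_def)
    qed (use carrier[OF x \<alpha>] carrier[OF y \<alpha>] in auto)
    then have "f x = f y"
      using fP[OF x] fP[OF y] by (intro PiE_ext[of "f x"]) auto
    then show ?thesis
      using bij x y by (auto simp: bij_betw_def dest: inj_onD)
  qed
  have fin: "finite (unit_indices L m)"
    by (simp add: unit_indices_def)
  have "(\<Sum>t\<in>unit_indices L m. c t x *\<^sub>C E t) = x" if x: "x \<in> B" for x
  proof (rule inj[OF _ x])
    show "(\<Sum>t\<in>unit_indices L m. c t x *\<^sub>C E t) \<in> B"
      by (intro complex_vector.subspace_sum complex_vector.subspace_scale sub EB)
    fix s assume s: "s \<in> unit_indices L m"
    have "c s (\<Sum>t\<in>unit_indices L m. c t x *\<^sub>C E t) = (\<Sum>t\<in>unit_indices L m. c t x * c s (E t))"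
      by (rule functional_on_subspace_sum[OF sub]) (use add scale s EB in auto)
    also have "\<dots> = (\<Sum>t\<in>unit_indices L m. if s = t then c t x else 0)"
      by (rule sum.cong) (auto simp: delta[OF s])
    also have "\<dots> = c s x"
      using s fin by simp
    finally show "c s (\<Sum>t\<in>unit_indices L m. c t x *\<^sub>C E t) = c s x" .
  qed
  then have "frame_on B (unit_indices L m) E c"
    using sub fin EB add scale by (auto simp: frame_on_def)
  moreover have "c (\<alpha>, i, j) (alg_mult A x y) = (\<Sum>k<m \<alpha>. c (\<alpha>, i, k) x * c (\<alpha>, k, j) y)"
    if "(\<alpha>, i, j) \<in> unit_indices L m" "x \<in> B" "y \<in> B" for \<alpha> i j x y
    using that carrier[OF that(2), of \<alpha>] carrier[OF that(3), of \<alpha>]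
    by (auto simp: c_def unit_indices_def f_mult scalar_prod_def atLeast0LessThan)
  ultimately show ?thesis
    using delta by blast
qed

section \<open>Integrality from the multiplicity matrix\<close>

context biconnected_markov
begin

lemma antipode_idempotent: "e \<cdot> e = e \<Longrightarrow> S e \<cdot> S e = S e"
  by (metis antipode_mult)

lemma cartan_product_idempotent:
  assumes "e \<in> K\<^sub>s" "f \<in> K\<^sub>t" "e \<cdot> e = e" "f \<cdot> f = f"
  shows "(e \<cdot> f) \<cdot> (e \<cdot> f) = e \<cdot> f"
  by (metis assms cartan_commute mult_assoc)

lemma markov_integrality:
  assumes iso: "iso_matrix_sum K K\<^sub>s L m" and m: "\<forall>\<alpha>\<in>{1..L}. 1 \<le> m \<alpha>"
    and d: "d = complex_vector.dim K\<^sub>s" and \<alpha>: "\<alpha> \<in> {1..L}" and \<beta>: "\<beta> \<in> {1..L}"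
  shows "real (m \<alpha>) * real (m \<beta>) / (l * (real d)\<^sup>2) \<in> \<nat>"
    and "(\<Sum>\<gamma>\<in>{1..L}. (m \<gamma>)\<^sup>2) = d" and "d \<noteq> 0"
proof -
  let ?U = "unit_indices L m"
  obtain E c where frame: "frame_on K\<^sub>s ?U E c"
    and delta: "\<And>s t. s \<in> ?U \<Longrightarrow> t \<in> ?U \<Longrightarrow> c s (E t) = (if s = t then 1 else 0)"
    and cmult: "\<And>\<alpha> i j x y. (\<alpha>, i, j) \<in> ?U \<Longrightarrow> x \<in> K\<^sub>s \<Longrightarrow> y \<in> K\<^sub>s \<Longrightarrow>
       c (\<alpha>, i, j) (x \<cdot> y) = (\<Sum>k<m \<alpha>. c (\<alpha>, i, k) x * c (\<alpha>, k, j) y)"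
    using iso_matrix_sum_units[OF iso subspace_cartan_s] by blast
  have U: "(\<alpha>, i, j) \<in> ?U \<longleftrightarrow> \<alpha> \<in> {1..L} \<and> i < m \<alpha> \<and> j < m \<alpha>" for \<alpha> i j
    by (auto simp: unit_indices_def)
  have fin: "finite ?U"
    by (simp add: unit_indices_def)
  have EK: "E t \<in> K\<^sub>s" if "t \<in> ?U" for t
    using frame that by (auto simp: frame_on_def)
  have expand: "(\<Sum>t\<in>?U. c t x *\<^sub>C E t) = x" if "x \<in> K\<^sub>s" for x
    using frame that by (simp add: frame_on_def)
  have inj: "x = y" if "x \<in> K\<^sub>s" "y \<in> K\<^sub>s" "\<And>t. t \<in> ?U \<Longrightarrow> c t x = c t y" for x y
  proof -
    have "x = (\<Sum>t\<in>?U. c t x *\<^sub>C E t)"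
      by (rule expand[OF that(1), symmetric])
    also have "\<dots> = (\<Sum>t\<in>?U. c t y *\<^sub>C E t)"
      by (rule sum.cong) (simp_all add: that(3))
    also have "\<dots> = y"
      by (rule expand[OF that(2)])
    finally show ?thesis .
  qed
  have zero: "c t 0 = 0" if "t \<in> ?U" for t
    using frame_on_coord_sum[OF frame that, of "{}" "\<lambda>_. 0"] by simp
  have Emult: "E (\<gamma>, i, j) \<cdot> E (\<delta>, k, h) = (if \<gamma> = \<delta> \<and> j = k then E (\<gamma>, i, h) else 0)"
    if 1: "(\<gamma>, i, j) \<in> ?U" and 2: "(\<delta>, k, h) \<in> ?U" for \<gamma> i j \<delta> k h
  proof (rule inj)
    show "E (\<gamma>, i, j) \<cdot> E (\<delta>, k, h) \<in> K\<^sub>s"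
      by (intro cartan_s_mult EK 1 2)
    show "(if \<gamma> = \<delta> \<and> j = k then E (\<gamma>, i, h) else 0) \<in> K\<^sub>s"
      using 1 2 by (auto simp: U intro!: EK complex_vector.subspace_0[OF subspace_cartan_s])
    fix t assume t: "t \<in> ?U"
    obtain \<kappa> r s where [simp]: "t = (\<kappa>, r, s)"
      by (cases t)
    have "c t (E (\<gamma>, i, j) \<cdot> E (\<delta>, k, h)) =
        (\<Sum>q<m \<kappa>. (if \<kappa> = \<gamma> \<and> r = i \<and> q = j then 1 else 0) * (if \<kappa> = \<delta> \<and> q = k \<and> s = h then 1 else 0))"
      unfolding \<open>t = _\<close> using t 1 2 by (subst cmult) (auto intro!: EK sum.cong simp: delta U)
    also have "\<dots> = (\<Sum>q<m \<kappa>. if q = j then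
        (if \<kappa> = \<gamma> \<and> r = i then 1 else 0) * (if \<kappa> = \<delta> \<and> j = k \<and> s = h then 1 else 0) else 0)"
      by (rule sum.cong) auto
    also have "\<dots> = (if j < m \<kappa> then
        (if \<kappa> = \<gamma> \<and> r = i then 1 else 0) * (if \<kappa> = \<delta> \<and> j = k \<and> s = h then 1 else 0) else 0)"
      by simp
    also have "\<dots> = c t (if \<gamma> = \<delta> \<and> j = k then E (\<gamma>, i, h) else 0)"
      using t 1 2 by (auto simp: delta U zero)
    finally show "c t (E (\<gamma>, i, j) \<cdot> E (\<delta>, k, h)) = c t (if \<gamma> = \<delta> \<and> j = k then E (\<gamma>, i, h) else 0)" .
  qed
  have \<tau>E: "\<tau> (E (\<gamma>, i, i)) = of_nat (m \<gamma>)" if "\<gamma> \<in> {1..L}" "i < m \<gamma>" for \<gamma> i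
  proof -
    have u: "(\<gamma>, i, i) \<in> ?U"
      using that by (simp add: U)
    have "\<tau> (E (\<gamma>, i, i)) = (\<Sum>t\<in>?U. c t (E (\<gamma>, i, i) \<cdot> E t))"
      by (rule \<tau>_cartan_s_trace[OF frame EK[OF u]])
    \<comment> \<open>Left multiplication by \<open>E (\<gamma>, i, i)\<close> fixes the
      \<open>m \<gamma>\<close> units in row i of block \<gamma> and annihilates the others.\<close>
    also have "\<dots> = (\<Sum>t\<in>?U. if t \<in> (\<lambda>j. (\<gamma>, i, j)) ` {..<m \<gamma>} then 1 else 0)"
      using u by (intro sum.cong refl) (auto simp: Emult delta zero U split: if_splits)
    also have "\<dots> = of_nat (card ((\<lambda>j. (\<gamma>, i, j)) ` {..<m \<gamma>}))"
      using that fin by (subst sum.inter_restrict[symmetric]) (auto simp: U Int_absorb1 image_subset_iff)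
    also have "\<dots> = of_nat (m \<gamma>)"
      by (subst card_image) (auto simp: inj_on_def)
    finally show ?thesis .
  qed
  have one: "(\<Sum>\<gamma>\<in>{1..L}. \<Sum>i<m \<gamma>. E (\<gamma>, i, i)) = \<^bold>1"
  proof -
    have "c (\<gamma>, i, j) \<^bold>1 = (if i = j then 1 else 0)" if u: "(\<gamma>, i, j) \<in> ?U" for \<gamma> i j
    proof -
      have u': "(\<gamma>, j, j) \<in> ?U"
        using u by (simp add: U)
      \<comment> \<open>The entries of 1 in column j are read off from 1 times the diagonal unit at
        j.\<close>
      have "(if i = j then 1 else 0) = c (\<gamma>, i, j) (\<^bold>1 \<cdot> E (\<gamma>, j, j))"
        by (simp add: one_left delta[OF u u'])
      also have "\<dots> = (\<Sum>k<m \<gamma>. c (\<gamma>, i, k) \<^bold>1 * (if k = j then 1 else 0))"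
        using u u' by (subst cmult) (auto simp: one_in_cartan EK delta U intro!: sum.cong)
      also have "\<dots> = (\<Sum>k<m \<gamma>. if k = j then c (\<gamma>, i, j) \<^bold>1 else 0)"
        by (rule sum.cong) auto
      also have "\<dots> = c (\<gamma>, i, j) \<^bold>1"
        using u by (simp add: U)
      finally show ?thesis
        by simp
    qed
    then have "(\<Sum>t\<in>?U. c t \<^bold>1 *\<^sub>C E t) = (\<Sum>(\<gamma>, i, j)\<in>?U. if i = j then E (\<gamma>, i, j) else 0)"
      by (intro sum.cong refl) (auto simp: scaleC_one)
    also have "\<dots> = (\<Sum>\<gamma>\<in>{1..L}. \<Sum>i<m \<gamma>. \<Sum>j<m \<gamma>. if i = j then E (\<gamma>, i, j) else 0)"
      by (simp add: unit_indices_def sum.Sigma[symmetric] sum.cartesian_product)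
    also have "\<dots> = (\<Sum>\<gamma>\<in>{1..L}. \<Sum>i<m \<gamma>. E (\<gamma>, i, i))"
      by (intro sum.cong refl) (simp add: sum.delta')
    finally show ?thesis
      by (simp add: expand one_in_cartan)
  qed
  have \<tau>1: "\<tau> \<^bold>1 = of_nat d"
    by (simp add: \<tau>_one d)
  have "\<tau> \<^bold>1 = (\<Sum>\<gamma>\<in>{1..L}. \<Sum>i<m \<gamma>. \<tau> (E (\<gamma>, i, i)))"
    unfolding one[symmetric] by (simp add: clinear_sum[OF \<tau>_linear])
  also have "\<dots> = of_nat (\<Sum>\<gamma>\<in>{1..L}. (m \<gamma>)\<^sup>2)"
    by (simp add: \<tau>E power2_eq_square)
  finally show dsum: "(\<Sum>\<gamma>\<in>{1..L}. (m \<gamma>)\<^sup>2) = d"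
    using \<tau>1 by (metis of_nat_eq_iff)
  show d0: "d \<noteq> 0"
  proof
    assume "d = 0"
    then have "m \<alpha> = 0"
      using dsum \<alpha> by simp
    then show False
      using bspec[OF m \<alpha>] by simp
  qed

  \<comment> \<open>A minimal idempotent of block \<gamma>; the index 0 exists because
    \<open>m \<gamma>\<close> is at least 1.\<close>
  define e where "e \<gamma> = E (\<gamma>, 0, 0)" for \<gamma>
  have U0: "(\<gamma>, 0, 0) \<in> ?U" if "\<gamma> \<in> {1..L}" for \<gamma>
    using bspec[OF m that] that by (simp add: U)
  have e: "e \<gamma> \<in> K\<^sub>s" "e \<gamma> \<cdot> e \<gamma> = e \<gamma>" "\<tau> (e \<gamma>) = of_nat (m \<gamma>)" if "\<gamma> \<in> {1..L}" for \<gamma>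
    using U0[OF that] \<tau>E[OF that, of 0] bspec[OF m that] EK Emult by (simp_all add: e_def)
  define b where "b = e \<alpha> \<cdot> S (e \<beta>)"
  have idem: "(e \<gamma> \<cdot> S (e \<delta>)) \<cdot> (e \<gamma> \<cdot> S (e \<delta>)) = e \<gamma> \<cdot> S (e \<delta>)"
    if "\<gamma> \<in> {1..L}" "\<delta> \<in> {1..L}" for \<gamma> \<delta>
    by (intro cartan_product_idempotent antipode_idempotent antipode_cartan e that)
  have \<tau>b: "\<tau> b = of_nat (m \<alpha>) * of_nat (m \<beta>) / of_nat d"
    using \<tau>_cartan_mult[OF e(1)[OF \<alpha>] antipode_cartan(1)[OF e(1)[OF \<beta>]]] d0
    by (simp add: b_def \<tau>1 \<tau>_antipode[OF e(1)[OF \<beta>]] e(3)[OF \<alpha>] e(3)[OF \<beta>] field_simps)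
  \<comment> \<open>The trace is a complex number known to be natural; the choice extracts it as a
    \<open>nat\<close> for indices in \<open>{1..L}\<close>.\<close>
  define N where "N \<gamma> \<delta> = (SOME n. LR_trace (e \<gamma> \<cdot> S (e \<delta>)) b = of_nat n)" for \<gamma> \<delta>
  have N: "LR_trace (e \<gamma> \<cdot> S (e \<delta>)) b = of_nat (N \<gamma> \<delta>)" if "\<gamma> \<in> {1..L}" "\<delta> \<in> {1..L}" for \<gamma> \<delta>
  proof -
    have "LR_trace (e \<gamma> \<cdot> S (e \<delta>)) b \<in> \<nat>"
      unfolding b_def by (intro LR_trace_idempotent idem that \<alpha> \<beta>)
    then show ?thesis
      unfolding N_def by (rule Nats_cases) (metis (mono_tags, lifting) someI)
  qed
  \<comment> \<open>The diagonal units of one block are equivalent idempotents, and \<open>S\<close>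
    of the connecting units commutes with \<open>e \<gamma>\<close>, so
    \<open>LR_trace_commute\<close> equates their traces.\<close>
  have move: "LR_trace (e \<gamma> \<cdot> S (E (\<delta>, i, i))) b = LR_trace (e \<gamma> \<cdot> S (e \<delta>)) b"
    if \<gamma>: "\<gamma> \<in> {1..L}" and \<delta>: "\<delta> \<in> {1..L}" and i: "i < m \<delta>" for \<gamma> \<delta> i
  proof -
    have u: "(\<delta>, i, 0) \<in> ?U" "(\<delta>, 0, i) \<in> ?U"
      using \<delta> i by (auto simp: U)
    let ?x = "S (E (\<delta>, 0, i))" and ?y = "S (E (\<delta>, i, 0))"
    have "E (\<delta>, i, i) = E (\<delta>, i, 0) \<cdot> E (\<delta>, 0, i)" "e \<delta> = E (\<delta>, 0, i) \<cdot> E (\<delta>, i, 0)"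
      using u by (simp_all add: Emult e_def)
    then have S: "S (E (\<delta>, i, i)) = ?x \<cdot> ?y" "S (e \<delta>) = ?y \<cdot> ?x"
      by (simp_all add: antipode_mult)
    have comm: "e \<gamma> \<cdot> ?x = ?x \<cdot> e \<gamma>"
      by (intro cartan_commute antipode_cartan e(1) EK u \<gamma>)
    have "LR_trace (e \<gamma> \<cdot> S (E (\<delta>, i, i))) b = LR_trace (?x \<cdot> (e \<gamma> \<cdot> ?y)) b"
      unfolding S by (metis comm mult_assoc)
    also have "\<dots> = LR_trace (e \<gamma> \<cdot> S (e \<delta>)) b"
      unfolding S by (subst LR_trace_commute) (simp add: mult_assoc)
    finally show ?thesis .
  qed
  let ?k = "real (m \<alpha>) * real (m \<beta>) / (l * (real d)\<^sup>2)"
  have "(\<Sum>\<delta>\<in>{1..L}. real (N \<gamma> \<delta> * m \<delta>)) = ?k * real (m \<gamma>)" if \<gamma>: "\<gamma> \<in> {1..L}" for \<gamma>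
  proof -
    have "(\<Sum>i<m \<delta>. LR_trace (e \<gamma> \<cdot> S (E (\<delta>, i, i))) b) = of_nat (m \<delta>) * of_nat (N \<gamma> \<delta>)"
      if "\<delta> \<in> {1..L}" for \<delta>
      using move[OF \<gamma> that] N[OF \<gamma> that] by simp
    then have "complex_of_real (\<Sum>\<delta>\<in>{1..L}. real (N \<gamma> \<delta> * m \<delta>)) =
        (\<Sum>\<delta>\<in>{1..L}. \<Sum>i<m \<delta>. LR_trace (e \<gamma> \<cdot> S (E (\<delta>, i, i))) b)"
      unfolding of_real_sum by (intro sum.cong refl) (simp add: mult.commute)
    also have "\<dots> = LR_trace (e \<gamma> \<cdot> S \<^bold>1) b"
      unfolding one[symmetric]
      by (simp add: clinear_sum[OF antipode_linear] clinear_sum[OF mult_linear_right] clinear_sum[OF clinear_LR_trace])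
    also have "\<dots> = of_nat (m \<gamma>) * \<tau> b / (complex_of_real l * of_nat d)"
      using LR_trace_cartan_s[OF e(1)[OF \<gamma>], of b] d0 by (simp add: antipode_one one_right e(3)[OF \<gamma>] \<tau>1)
    also have "\<dots> = complex_of_real (?k * real (m \<gamma>))"
      by (simp add: \<tau>b power2_eq_square field_simps)
    finally show ?thesis
      by (simp only: of_real_eq_iff)
  qed
  then show "?k \<in> \<nat>"
    using \<alpha> bspec[OF m \<alpha>] by (intro eigenvalue_nat[of "{1..L}" N m ?k \<alpha>]) auto
qed

end

theorem corollary6p1:
  fixes K :: "'a::complex_vector weak_kac"
    and l :: real and L d :: nat and m :: "nat \<Rightarrow> nat"
  assumes "weak_kac_algebra K"
    and "biconnected K"
    and "markov_condition K l"
    and "\<forall>\<alpha>\<in>{1..L}. 1 \<le> m \<alpha>"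
    and "iso_matrix_sum K (cartan_s K) L m"
    and "iso_matrix_sum K (cartan_t K) L m"
    and "d = complex_vector.dim (cartan_s K)"
  shows "\<forall>\<alpha>\<in>{1..L}. \<exists>n::nat. inverse l = real n \<and> d\<^sup>2 dvd (m \<alpha>)\<^sup>2 * n"
proof
  fix \<alpha> assume \<alpha>: "\<alpha> \<in> {1..L}"
  obtain p \<tau> where "haar_projection K p" "haar_trace K \<tau>" "0 < l"
      "expect_t K \<tau> p = complex_of_real l *\<^sub>C alg_one K"
    using assms(3) unfolding markov_condition_def by blast
  then interpret biconnected_markov K p \<tau> l
    using assms(1,2) weak_kac_algebra.cartan_Int_scalars[OF assms(1)]
    by (auto simp: biconnected_markov_def biconnected_markov_axioms_def biconnected_def)
  note int = markov_integrality[OF assms(5,4,7)]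
  have "d \<noteq> 0"
    by (rule int(3)[OF \<alpha> \<alpha>])
  let ?k = "\<lambda>\<beta> \<gamma>. real (m \<beta>) * real (m \<gamma>) / (l * (real d)\<^sup>2)"
  \<comment> \<open>The floor names the natural number that \<open>?k\<close> is already known to
    be.\<close>
  have k: "?k \<beta> \<gamma> = real (nat \<lfloor>?k \<beta> \<gamma>\<rfloor>)" if "\<beta> \<in> {1..L}" "\<gamma> \<in> {1..L}" for \<beta> \<gamma>
    using int(1)[OF that] by (elim Nats_cases) simp
  \<comment> \<open>Weighting the integers \<open>?k \<beta> \<gamma>\<close> by
    \<open>m \<beta> * m \<gamma>\<close> makes the double sum factor; as the squares of
    \<open>m\<close> add up to d, both factors equal d and cancel the denominator up to
    \<open>l\<close>.\<close>
  define n where "n = (\<Sum>\<beta>\<in>{1..L}. \<Sum>\<gamma>\<in>{1..L}. m \<beta> * m \<gamma> * nat \<lfloor>?k \<beta> \<gamma>\<rfloor>)"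
  have "real n = (\<Sum>\<beta>\<in>{1..L}. \<Sum>\<gamma>\<in>{1..L}. real (m \<beta>) * real (m \<gamma>) * ?k \<beta> \<gamma>)"
    unfolding n_def of_nat_sum of_nat_mult by (intro sum.cong refl) (simp only: k[symmetric])
  also have "\<dots> = (\<Sum>\<beta>\<in>{1..L}. real ((m \<beta>)\<^sup>2)) * (\<Sum>\<gamma>\<in>{1..L}. real ((m \<gamma>)\<^sup>2)) / (l * (real d)\<^sup>2)"
    by (simp add: sum_product sum_divide_distrib power2_eq_square mult_ac)
  also have "\<dots> = inverse l"
    using \<open>d \<noteq> 0\<close> l_pos unfolding of_nat_sum[symmetric] int(2)[OF \<alpha> \<alpha>]
    by (simp add: power2_eq_square field_simps)
  finally have n: "inverse l = real n" ..
  \<comment> \<open>The diagonal case of \<open>?k\<close> gives the quotient of the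
    divisibility.\<close>
  have "real ((m \<alpha>)\<^sup>2 * n) = (real d)\<^sup>2 * ?k \<alpha> \<alpha>"
    using \<open>d \<noteq> 0\<close> l_pos by (simp add: n[symmetric] power2_eq_square field_simps)
  also have "\<dots> = real (d\<^sup>2 * nat \<lfloor>?k \<alpha> \<alpha>\<rfloor>)"
    by (simp only: k[OF \<alpha> \<alpha>, symmetric] of_nat_mult of_nat_power)
  finally have "(m \<alpha>)\<^sup>2 * n = d\<^sup>2 * nat \<lfloor>?k \<alpha> \<alpha>\<rfloor>"
    by (simp only: of_nat_eq_iff)
  with n show "\<exists>n::nat. inverse l = real n \<and> d\<^sup>2 dvd (m \<alpha>)\<^sup>2 * n"
    by (metis dvd_triv_left)
qed

end
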